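(* Let $n\ge1$ and let $\alpha\in(0,n+2)$, $\lambda$, $\sigma$ be constants with $\lambda\ge\frac{n+2}{n}$ and $0\le\sigma<1-\frac{\alpha-2}{n+2}\lambda$. Suppose $u$ is a nonnegative function with $u\in C^{2,1}(\mathbb{R}^n\times(0,16))\cap L^\lambda(\mathbb{R}^n\times(0,16))$ satisfying $$0\le u_t-\Delta u\le \Big(\iint_{\mathbb{R}^n\times(0,16)}\Phi(x-y,t-s)^{\alpha/n}u(y,s)^\lambda\,dy\,ds\Big)\,u(x,t)^\sigma\quad\text{in }B_4(0)\times(0,16).$$ Then $\max_{|x|\le1}u(x,t)=o\big(t^{-\frac{n+2}{2\lambda}}\big)$ as $t\to0^+$.
   Context: $\Phi$ is the heat kernel: $\Phi(x,t)=(4\pi t)^{-n/2}e^{-|x|^2/(4t)}$ for $t>0$ and $\Phi(x,t)=0$ for $t\le0$. $B_r(0)$ is the open ball of radius $r$ centered at the origin of $\mathbb{R}^n$. *)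

theory Defs
  imports "HOL-Analysis.Analysis" "HOL-Library.Landau_Symbols"
begin

definition heat_kernel :: "'a::euclidean_space \<Rightarrow> real \<Rightarrow> real" where
  "heat_kernel x t = (if t > 0 then (4 * pi * t) powr (- real DIM('a) / 2) * exp (- (norm x)\<^sup>2 / (4 * t)) else 0)"

definition npow :: "real \<Rightarrow> real \<Rightarrow> real" where
  "npow a p = (if p = 0 then 1 else a powr p)"

definition dx :: "('a::euclidean_space \<Rightarrow> real \<Rightarrow> real) \<Rightarrow> 'a \<Rightarrow> 'a \<Rightarrow> real \<Rightarrow> real" where
  "dx u i x t = deriv (\<lambda>h. u (x + h *\<^sub>R i) t) 0"

definition dt :: "('a \<Rightarrow> real \<Rightarrow> real) \<Rightarrow> 'a \<Rightarrow> real \<Rightarrow> real" where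
  "dt u x t = deriv (\<lambda>s. u x s) t"

definition laplacian :: "('a::euclidean_space \<Rightarrow> real \<Rightarrow> real) \<Rightarrow> 'a \<Rightarrow> real \<Rightarrow> real" where
  "laplacian u x t = (\<Sum>i\<in>Basis. dx (dx u i) i x t)"

definition C21_on :: "('a::euclidean_space \<Rightarrow> real \<Rightarrow> real) \<Rightarrow> 'a set \<Rightarrow> real set \<Rightarrow> bool" where
  "C21_on u \<Omega> I \<longleftrightarrow>
     continuous_on (\<Omega> \<times> I) (\<lambda>p. u (fst p) (snd p)) \<and>
     (\<forall>i\<in>Basis. \<forall>x\<in>\<Omega>. \<forall>t\<in>I. ((\<lambda>h. u (x + h *\<^sub>R i) t) has_real_derivative dx u i x t) (at 0)) \<and>
     (\<forall>i\<in>Basis. continuous_on (\<Omega> \<times> I) (\<lambda>p. dx u i (fst p) (snd p))) \<and>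
     (\<forall>i\<in>Basis. \<forall>j\<in>Basis. \<forall>x\<in>\<Omega>. \<forall>t\<in>I.
        ((\<lambda>h. dx u i (x + h *\<^sub>R j) t) has_real_derivative dx (dx u i) j x t) (at 0)) \<and>
     (\<forall>i\<in>Basis. \<forall>j\<in>Basis. continuous_on (\<Omega> \<times> I) (\<lambda>p. dx (dx u i) j (fst p) (snd p))) \<and>
     (\<forall>x\<in>\<Omega>. \<forall>t\<in>I. ((\<lambda>s. u x s) has_real_derivative dt u x t) (at t)) \<and>
     continuous_on (\<Omega> \<times> I) (\<lambda>p. dt u (fst p) (snd p))"

end

theory Submission
  imports Defs "HOL-Probability.Distributions"
begin

text \<open>
  Write \<open>\<gamma> = (n + 2) / \<lambda>\<close>. For \<open>0 < t\<^sub>0 < t\<close> let \<open>(x', t')\<close> maximise \<open>d\<^sup>\<gamma> u\<close> over \<open>|x| \<le> 2\<close>,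
  \<open>t\<^sub>0 \<le> s \<le> t\<close>, where \<open>d = min (2 - |x|) (sqrt (s - t\<^sub>0))\<close>. At the maximum, \<open>u \<le> 2\<^sup>\<gamma> M\<close> with
  \<open>M = u(x', t')\<close> on the backward parabolic cylinder of radius \<open>d/2\<close>. If the maximal value
  exceeded \<open>\<epsilon>\<close>, one could pick \<open>\<rho> \<le> d/4\<close> with \<open>a = M \<rho>\<^sup>\<gamma>\<close> between a positive constant depending on
  \<open>\<epsilon>\<close> and \<open>1\<close>. Splitting the potential at parabolic distance \<open>\<rho>\<close> bounds it by \<open>C \<rho>\<^sup>-\<^sup>\<alpha>\<close>, so the rescaled
  function \<open>w(y, s) = u(x' + \<rho> y, t' + \<rho>\<^sup>2 s) / M\<close> satisfies \<open>w\<^sub>t - \<Delta>w \<le> C \<rho>\<^sup>e a\<^sup>\<sigma>\<^sup>-\<^sup>1\<close> with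
  \<open>e = 2 - \<alpha> + \<gamma>(1 - \<sigma>) > 0\<close>. Since \<open>\<rho>\<^sup>2 \<le> t\<close> and the mass of \<open>u\<^sup>\<lambda>\<close> on \<open>(0, t)\<close> tends to \<open>0\<close>, the mean
  value inequality for subsolutions of the heat equation yields \<open>1 = w(0, 0) < 1\<close> for small \<open>t\<close>.
\<close>

section \<open>Cutoff functions and integration by parts\<close>

text \<open>The exponent \<open>\<gamma>\<close> is the one for which
  \<open>M powr lam * \<rho> powr (n + 2) = a powr lam\<close>: the mass of
  \<open>w powr lam\<close> on the unit cylinder is that of \<open>u powr lam\<close> on the
  original cylinder, divided by \<open>a powr lam\<close>. This is why \<open>a\<close> is trapped
  from both sides. The lower bound keeps that quotient small; the upper bound keeps the near part of
  the potential at the order \<open>\<rho> powr (- alpha)\<close> of the far part, whose mass is at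
  most 1. Since no upper bound on \<open>d powr \<gamma> * M\<close> is available,
  \<open>\<rho>\<close> may have to be much smaller than \<open>d\<close>. The positive time
  \<open>t0\<close> is there because \<open>u\<close> need not be continuous, or even bounded, at
  time 0; no constant depends on it, so it can be sent to 0 in the end. Positivity of the exponent
  \<open>e\<close> is the upper bound on \<open>sigma\<close> multiplied by
  \<open>\<gamma>\<close>.\<close>

lemma has_real_derivative_cube_pos_part:
  "((\<lambda>x::real. (max 0 x)^3) has_real_derivative 3 * (max 0 x)^2) (at x)"
proof (cases "x = 0")
  case True
  have "((\<lambda>h::real. (max 0 h)^3 / h) \<longlongrightarrow> 0) (at 0)"
  proof (rule tendsto_sandwich[of "\<lambda>_. 0" _ _ "\<lambda>h. h^2"])
    show "eventually (\<lambda>h::real. 0 \<le> max 0 h ^ 3 / h) (at 0)"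
      by (rule always_eventually) (auto simp: max_def power3_eq_cube field_simps mult_less_0_iff)
    show "eventually (\<lambda>h::real. max 0 h ^ 3 / h \<le> h^2) (at 0)"
      by (rule always_eventually) (auto simp: max_def power3_eq_cube power2_eq_square)
    show "((\<lambda>h::real. h^2) \<longlongrightarrow> 0) (at 0)" by (auto intro!: tendsto_eq_intros)
  qed auto
  then show ?thesis using True by (simp add: DERIV_def)
next
  case False
  then consider "x > 0" | "x < 0" by linarith
  then show ?thesis
  proof cases
    case 1
    have "((\<lambda>x::real. x^3) has_real_derivative 3 * (max 0 x)^2) (at x)"
      using 1 by (auto intro!: derivative_eq_intros simp: max_def)
    then show ?thesis
      by (rule has_field_derivative_transform_within_open[where S="{0<..}"]) (use 1 in auto)
  next
    case 2
    have "((\<lambda>x::real. 0) has_real_derivative 3 * (max 0 x)^2) (at x)"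
      using 2 by (auto intro!: derivative_eq_intros simp: max_def)
    then show ?thesis
      by (rule has_field_derivative_transform_within_open[where S="{..<0}"]) (use 2 in auto)
  qed
qed

lemma has_real_derivative_square_pos_part:
  "((\<lambda>x::real. (max 0 x)^2) has_real_derivative 2 * max 0 x) (at x)"
proof (cases "x = 0")
  case True
  have "((\<lambda>h::real. (max 0 h)^2 / h) \<longlongrightarrow> 0) (at 0)"
  proof (rule tendsto_sandwich[of "\<lambda>_. 0" _ _ "\<lambda>h. \<bar>h\<bar>"])
    show "eventually (\<lambda>h::real. 0 \<le> max 0 h ^ 2 / h) (at 0)"
      by (rule always_eventually) (auto simp: max_def power2_eq_square field_simps)
    show "eventually (\<lambda>h::real. max 0 h ^ 2 / h \<le> \<bar>h\<bar>) (at 0)"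
      by (rule always_eventually) (auto simp: max_def power2_eq_square)
    show "((\<lambda>h::real. \<bar>h\<bar>) \<longlongrightarrow> 0) (at 0)" by (auto intro!: tendsto_eq_intros)
  qed auto
  then show ?thesis using True by (simp add: DERIV_def)
next
  case False
  then consider "x > 0" | "x < 0" by linarith
  then show ?thesis
  proof cases
    case 1
    have "((\<lambda>x::real. x^2) has_real_derivative 2 * max 0 x) (at x)"
      using 1 by (auto intro!: derivative_eq_intros simp: max_def)
    then show ?thesis
      by (rule has_field_derivative_transform_within_open[where S="{0<..}"]) (use 1 in auto)
  next
    case 2
    have "((\<lambda>x::real. 0) has_real_derivative 2 * max 0 x) (at x)"
      using 2 by (auto intro!: derivative_eq_intros simp: max_def)
    then show ?thesis
      by (rule has_field_derivative_transform_within_open[where S="{..<0}"]) (use 2 in auto)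
  qed
qed

text \<open>The explicit choice is \<open>P (1 - P (2*x - 1))\<close> with \<open>P\<close> the
  cubed positive part, which is C^2 and hence smooth enough to be tested with the heat operator. The
  last clause is quantitative: it later bounds the approximate Dirac mass from below.\<close>

lemma cutoff_function_exists:
  obtains \<eta> \<eta>1 \<eta>2 :: "real \<Rightarrow> real" and B :: real
  where "\<And>x. (\<eta> has_real_derivative \<eta>1 x) (at x)" "\<And>x. (\<eta>1 has_real_derivative \<eta>2 x) (at x)"
    "continuous_on UNIV \<eta>2"
    "\<And>x. 0 \<le> \<eta> x" "\<And>x. \<eta> x \<le> 1" "\<And>x. \<eta>1 x \<le> 0"
    "\<And>x. x \<le> 1/2 \<Longrightarrow> \<eta> x = 1" "\<And>x. 1 \<le> x \<Longrightarrow> \<eta> x = 0"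
    "\<And>x. x \<le> 1/2 \<or> 1 \<le> x \<Longrightarrow> \<eta>1 x = 0" "\<And>x. x \<le> 1/2 \<or> 1 \<le> x \<Longrightarrow> \<eta>2 x = 0"
    "\<And>x. \<bar>\<eta>1 x\<bar> \<le> B" "\<And>x. \<bar>\<eta>2 x\<bar> \<le> B"
    "\<And>x. 7/10 \<le> x \<Longrightarrow> x \<le> 8/10 \<Longrightarrow> 1 \<le> - \<eta>1 x"
proof -
  define P where "P = (\<lambda>x::real. (max 0 x)^3)"
  define r where "r = (\<lambda>x::real. 1 - P (2*x - 1))"
  define \<eta> where "\<eta> = (\<lambda>x. P (r x))"
  define r1 where "r1 = (\<lambda>x::real. - (3 * (max 0 (2*x-1))^2 * 2))"
  define r2 where "r2 = (\<lambda>x::real. - (3 * (2 * max 0 (2*x-1) * 2) * 2))"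
  define \<eta>1 where "\<eta>1 = (\<lambda>x. 3 * (max 0 (r x))^2 * r1 x)"
  define \<eta>2 where "\<eta>2 = (\<lambda>x. 3 * (2 * max 0 (r x) * r1 x) * r1 x + 3 * (max 0 (r x))^2 * r2 x)"
  have lin: "((\<lambda>x::real. 2*x-1) has_real_derivative 2) (at x)" for x
    by (auto intro!: derivative_eq_intros)
  have dr: "(r has_real_derivative r1 x) (at x)" for x
    unfolding r_def r1_def P_def
    using DERIV_diff[OF DERIV_const[of 1] DERIV_chain2[OF has_real_derivative_cube_pos_part lin]] by simp
  have dr1: "(r1 has_real_derivative r2 x) (at x)" for x
    unfolding r1_def r2_def
    by (rule derivative_eq_intros DERIV_chain2[OF has_real_derivative_square_pos_part lin] refl | simp)+
  have d1: "(\<eta> has_real_derivative \<eta>1 x) (at x)" for x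
    unfolding \<eta>_def \<eta>1_def P_def
    using DERIV_chain2[OF has_real_derivative_cube_pos_part dr] by simp
  have d2: "(\<eta>1 has_real_derivative \<eta>2 x) (at x)" for x
    unfolding \<eta>1_def \<eta>2_def
    by (rule derivative_eq_intros DERIV_chain2[OF has_real_derivative_square_pos_part dr] dr1 refl | simp)+
  have c2: "continuous_on UNIV \<eta>2"
    unfolding \<eta>2_def r_def r1_def r2_def P_def by (intro continuous_intros)
  have c1: "continuous_on UNIV \<eta>1"
    unfolding \<eta>1_def r_def r1_def r2_def P_def by (intro continuous_intros)
  have rl: "r x = 1" "r1 x = 0" "r2 x = 0" if "x \<le> 1/2" for x
    using that by (auto simp: r_def P_def r1_def r2_def max_def)
  have rr: "r x \<le> 0" if "x \<ge> 1" for x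
  proof -
    have "1 \<le> (max 0 (2*x-1))^3" by (rule one_le_power) (use that in auto)
    then show ?thesis by (simp add: r_def P_def)
  qed
  have rle: "r x \<le> 1" for x by (simp add: r_def P_def)
  have z1: "\<eta>1 x = 0" if "x \<le> 1/2 \<or> 1 \<le> x" for x
    using that rl[of x] rr[of x] by (auto simp: \<eta>1_def max_def)
  have z2: "\<eta>2 x = 0" if "x \<le> 1/2 \<or> 1 \<le> x" for x
    using that rl[of x] rr[of x] by (auto simp: \<eta>2_def max_def)
  obtain B1 where B1: "\<And>x. x \<in> {0..1} \<Longrightarrow> \<bar>\<eta>1 x\<bar> \<le> B1"
    using compact_imp_bounded[OF compact_continuous_image[OF continuous_on_subset[OF c1 subset_UNIV] compact_Icc[of 0 1]]]
    unfolding bounded_iff by (metis image_eqI real_norm_def)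
  obtain B2 where B2: "\<And>x. x \<in> {0..1} \<Longrightarrow> \<bar>\<eta>2 x\<bar> \<le> B2"
    using compact_imp_bounded[OF compact_continuous_image[OF continuous_on_subset[OF c2 subset_UNIV] compact_Icc[of 0 1]]]
    unfolding bounded_iff by (metis image_eqI real_norm_def)
  define B where "B = max 0 (max B1 B2)"
  have b1: "\<bar>\<eta>1 x\<bar> \<le> B" for x
    using B1[of x] z1[of x] by (cases "x \<in> {0..1}") (auto simp: B_def)
  have b2: "\<bar>\<eta>2 x\<bar> \<le> B" for x
    using B2[of x] z2[of x] by (cases "x \<in> {0..1}") (auto simp: B_def)
  \<comment> \<open>Here \<open>2*x - 1\<close> lies in [4/10, 6/10], so \<open>r x\<close> is at
    least 1 - 0.216 = 0.784, and \<open>- \<eta>1 x\<close>, which is 18 times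
    \<open>(r x)^2 * (2*x-1)^2\<close>, is at least 1.77.\<close>
  have low: "1 \<le> - \<eta>1 x" if x: "7/10 \<le> x" "x \<le> 8/10" for x
  proof -
    have "(2*x-1)^3 \<le> (6/10)^3" by (rule power_mono) (use x in auto)
    then have r: "r x \<ge> 784/1000" using x by (simp add: r_def P_def power3_eq_cube)
    then have r': "(max 0 (r x))^2 \<ge> (784/1000)^2"
      by (intro power_mono) auto
    have s: "(2*x-1)^2 \<ge> (4/10)^2" by (rule power_mono) (use x in auto)
    have "(784/1000)^2 * (4/10)^2 \<le> (max 0 (r x))^2 * (2*x-1)^2"
      by (rule mult_mono) (use r' s in auto)
    then show ?thesis using x by (simp add: \<eta>1_def r1_def power2_eq_square)
  qed
  show thesis
  proof (rule that[of \<eta> \<eta>1 \<eta>2 B])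
    show "0 \<le> \<eta> x" for x by (simp add: \<eta>_def P_def)
    show "\<eta> x \<le> 1" for x using rle[of x] by (auto simp: \<eta>_def P_def max_def power_le_one)
    show "\<eta>1 x \<le> 0" for x by (auto simp: \<eta>1_def r1_def intro!: mult_nonneg_nonpos)
    show "\<eta> x = 1" if "x \<le> 1/2" for x using rl[OF that] by (simp add: \<eta>_def P_def)
    show "\<eta> x = 0" if "1 \<le> x" for x using rr[OF that] by (simp add: \<eta>_def P_def max_def)
  qed (use d1 d2 c2 z1 z2 b1 b2 low in auto)
qed

section \<open>Integrals of derivatives of compactly supported functions\<close>

lemma integrable_continuous_compact_support:
  fixes h :: "'b::euclidean_space \<Rightarrow> real"
  assumes "continuous_on UNIV h" "compact K" "\<And>p. p \<notin> K \<Longrightarrow> h p = 0"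
  shows "integrable lborel h"
proof -
  have "integrable lborel (\<lambda>x. indicator K x *\<^sub>R h x)"
    by (rule borel_integrable_compact[OF assms(2)]) (rule continuous_on_subset[OF assms(1)], simp)
  moreover have "(\<lambda>x. indicator K x *\<^sub>R h x) = h"
    using assms(3) by (auto simp: fun_eq_iff indicator_def)
  ultimately show ?thesis by simp
qed

text \<open>The difference quotients of \<open>h\<close> integrate to zero by translation invariance.\<close>

lemma integral_directional_derivative_eq_0:
  fixes h D :: "'b::euclidean_space \<Rightarrow> real"
  assumes der: "\<And>p. ((\<lambda>r. h (p + r *\<^sub>R e)) has_real_derivative D p) (at 0)"
    and contD: "continuous_on UNIV D" and conth: "continuous_on UNIV h"
    and K: "compact K" and h0: "\<And>p. p \<notin> K \<Longrightarrow> h p = 0" and D0: "\<And>p. p \<notin> K \<Longrightarrow> D p = 0"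
  shows "(\<integral>p. D p \<partial>lborel) = 0"
proof -
  have "bounded (D ` K)"
    by (intro compact_imp_bounded compact_continuous_image K continuous_on_subset[OF contD]) auto
  then obtain B where B: "\<And>p. p \<in> K \<Longrightarrow> \<bar>D p\<bar> \<le> B" and Bp: "B > 0"
    unfolding bounded_pos by auto
  have B': "\<bar>D p\<bar> \<le> B" for p using B[of p] D0[of p] Bp by (cases "p \<in> K") auto
  \<comment> \<open>\<open>K'\<close> collects the points \<open>p\<close> for which
    \<open>p + r e\<close> meets \<open>K\<close> for some \<open>r\<close> in [0, 1]. Off
    \<open>K'\<close> every difference quotient vanishes, because the steps \<open>q k\<close> are
    at most 1; on it the mean value theorem bounds the quotient by \<open>B\<close>. This gives one
    integrable majorant for all \<open>k\<close>.\<close>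
  define K' where "K' = (\<lambda>(p, r). p - r *\<^sub>R e) ` (K \<times> {0..1::real})"
  have K': "compact K'"
    unfolding K'_def
    by (intro compact_continuous_image compact_Times K compact_Icc)
       (auto simp: case_prod_unfold intro!: continuous_intros)
  define q where "q = (\<lambda>k::nat. 1 / (real k + 1))"
  have qpos: "q k > 0" "q k \<le> 1" for k by (auto simp: q_def)
  have qlim: "q \<longlonglongrightarrow> 0" unfolding q_def using LIMSEQ_inverse_real_of_nat
    by (simp add: inverse_eq_divide add.commute)
  define f where "f = (\<lambda>k p. (h (p + q k *\<^sub>R e) - h p) / q k)"
  have inth: "integrable lborel h" by (rule integrable_continuous_compact_support[OF conth K h0])
  have inth': "integrable lborel (\<lambda>p. h (p + v))" and
    transl: "(\<integral>p. h (p + v) \<partial>lborel) = (\<integral>p. h p \<partial>lborel)" for v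
  proof -
    have meas: "h \<in> borel_measurable borel" using inth by auto
    have "integrable (distr lborel borel ((+) v)) h" by (simp add: lborel_distr_plus inth)
    then show "integrable lborel (\<lambda>p. h (p + v))"
      by (subst (asm) integrable_distr_eq) (use meas in \<open>auto simp: add.commute\<close>)
    have "(\<integral>p. h p \<partial>lborel) = (\<integral>p. h p \<partial>distr lborel borel ((+) v))" by (simp add: lborel_distr_plus)
    also have "\<dots> = (\<integral>p. h (v + p) \<partial>lborel)"
      by (subst integral_distr) (use meas in auto)
    finally show "(\<integral>p. h (p + v) \<partial>lborel) = (\<integral>p. h p \<partial>lborel)" by (simp add: add.commute)
  qed
  have int0: "(\<integral>p. f k p \<partial>lborel) = 0" for k
    unfolding f_def by (simp add: inth inth' transl)
  have "(\<lambda>k. \<integral>p. f k p \<partial>lborel) \<longlonglongrightarrow> (\<integral>p. D p \<partial>lborel)"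
  proof (rule integral_dominated_convergence[where w="\<lambda>p. B * indicator K' p"])
    show "D \<in> borel_measurable lborel" using contD by (simp add: borel_measurable_continuous_onI)
    show "f k \<in> borel_measurable lborel" for k
      unfolding f_def using inth inth' by (intro borel_measurable_divide borel_measurable_diff) auto
    show "integrable lborel (\<lambda>p. B * indicator K' p)"
      using borel_integrable_compact[OF K', of "\<lambda>_. B"] by (simp add: mult.commute)
    show "AE p in lborel. (\<lambda>k. f k p) \<longlonglongrightarrow> D p"
    proof (rule AE_I2)
      fix p
      have "((\<lambda>r. (h (p + r *\<^sub>R e) - h p) / r) \<longlongrightarrow> D p) (at 0)"
        using der[of p] by (simp add: DERIV_def)
      moreover have "filterlim q (at 0) sequentially"
        using qlim qpos(1) by (auto simp: filterlim_at intro!: always_eventually) (metis less_irrefl)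
      ultimately show "(\<lambda>k. f k p) \<longlonglongrightarrow> D p"
        unfolding f_def by (rule filterlim_compose)
    qed
    show "AE p in lborel. norm (f k p) \<le> B * indicator K' p" for k
    proof (rule AE_I2)
      fix p
      have dr: "((\<lambda>r. h (p + r *\<^sub>R e)) has_real_derivative D (p + r *\<^sub>R e)) (at r)" for r
        using der[of "p + r *\<^sub>R e"] DERIV_shift[of "\<lambda>r. h (p + r *\<^sub>R e)" _ 0 r]
        by (simp add: algebra_simps)
      show "norm (f k p) \<le> B * indicator K' p"
      proof (cases "p \<in> K'")
        case True
        obtain z where "h (p + q k *\<^sub>R e) - h (p + 0 *\<^sub>R e) = (q k - 0) * D (p + z *\<^sub>R e)"
          using MVT2[of 0 "q k" "\<lambda>r. h (p + r *\<^sub>R e)" "\<lambda>r. D (p + r *\<^sub>R e)"] dr qpos(1) by blast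
        then have "f k p = D (p + z *\<^sub>R e)" using qpos(1)[of k] by (simp add: f_def)
        then show ?thesis using True B' by simp
      next
        case False
        have out: "p + r *\<^sub>R e \<notin> K" if "r \<in> {0..1}" for r
          using False that unfolding K'_def by (force simp: image_iff)
        have "h (p + q k *\<^sub>R e) = 0" "h p = 0"
          using out[of "q k"] out[of 0] qpos[of k] h0 by auto
        then show ?thesis using Bp by (simp add: f_def)
      qed
    qed
  qed
  then show ?thesis using int0 by (simp add: LIMSEQ_const_iff)
qed

text \<open>\<open>w\<close> is regular only for times in an open set. A product with a test
  function supported inside that region extends by zero, because the open sets \<open>U\<close> and
  \<open>- K\<close> cover the whole space.\<close>

lemma continuous_on_UNIV_of_closed_support:
  fixes f :: "'b::topological_space \<Rightarrow> real"
  assumes "continuous_on U f" "open U" "closed K" "K \<subseteq> U" "\<And>p. p \<notin> K \<Longrightarrow> f p = 0"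
  shows "continuous_on UNIV f"
proof -
  have "continuous_on (- K) f"
    using continuous_on_const by (rule continuous_on_eq) (use assms(5) in auto)
  then have "continuous_on (U \<union> - K) f"
    by (intro continuous_on_open_Un assms) (use assms in auto)
  moreover have "U \<union> - K = UNIV" using assms(4) by auto
  ultimately show ?thesis by simp
qed

lemma has_real_derivative_0_off_closed_support:
  fixes f :: "'b::real_normed_vector \<Rightarrow> real"
  assumes "closed K" "p \<notin> K" "\<And>p. p \<notin> K \<Longrightarrow> f p = 0"
  shows "((\<lambda>r. f (p + r *\<^sub>R e)) has_real_derivative 0) (at 0)"
proof -
  have o: "open ((\<lambda>r::real. p + r *\<^sub>R e) -` (- K))"
    by (intro open_vimage) (use assms in \<open>auto intro!: continuous_intros\<close>)
  have d: "((\<lambda>r::real. 0::real) has_real_derivative 0) (at 0)" by simp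
  show ?thesis
    by (rule has_field_derivative_transform_within_open[OF d o]) (simp_all add: assms)
qed

text \<open>The derivatives are carried as explicit functions, taken along the directions
  \<open>(i, 0)\<close> and \<open>(0, 1)\<close> of the product space, the form in which their
  integrals can be shown to vanish. Only pure second derivatives are recorded, since they enter
  through the Laplacian.\<close>

definition parabolic_derivs ::
  "real set \<Rightarrow> ('a::euclidean_space \<times> real \<Rightarrow> real) \<Rightarrow> ('a \<Rightarrow> 'a \<times> real \<Rightarrow> real) \<Rightarrow>
   ('a \<Rightarrow> 'a \<times> real \<Rightarrow> real) \<Rightarrow> ('a \<times> real \<Rightarrow> real) \<Rightarrow> bool" where
  "parabolic_derivs I w wx wxx wt \<longleftrightarrow>
     (\<forall>i\<in>Basis. \<forall>p. snd p \<in> I \<longrightarrow> ((\<lambda>h. w (p + h *\<^sub>R (i, 0))) has_real_derivative wx i p) (at 0)) \<and>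
     (\<forall>i\<in>Basis. \<forall>p. snd p \<in> I \<longrightarrow> ((\<lambda>h. wx i (p + h *\<^sub>R (i, 0))) has_real_derivative wxx i p) (at 0)) \<and>
     (\<forall>p. snd p \<in> I \<longrightarrow> ((\<lambda>h. w (p + h *\<^sub>R (0, 1))) has_real_derivative wt p) (at 0)) \<and>
     continuous_on (UNIV \<times> I) w \<and> continuous_on (UNIV \<times> I) wt \<and>
     (\<forall>i\<in>Basis. continuous_on (UNIV \<times> I) (wx i)) \<and>
     (\<forall>i\<in>Basis. continuous_on (UNIV \<times> I) (wxx i))"

text \<open>The two integrands differ by exact derivatives of compactly supported functions:
  \<open>\<psi> * wxx i - w * \<psi>xx i\<close> is the derivative of
  \<open>\<psi> * wx i - w * \<psi>x i\<close> along \<open>i\<close>, and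
  \<open>\<psi> * wt + w * \<psi>t\<close> is that of \<open>\<psi> * w\<close> in time. Their
  integrals vanish.\<close>

lemma green_identity_heat:
  fixes w \<psi> :: "'a::euclidean_space \<times> real \<Rightarrow> real"
  assumes I: "open I" and w: "parabolic_derivs I w wx wxx wt"
    and \<psi>: "parabolic_derivs UNIV \<psi> \<psi>x \<psi>xx \<psi>t"
    and K: "compact K" "K \<subseteq> UNIV \<times> I"
    and p0: "\<And>p. p \<notin> K \<Longrightarrow> \<psi> p = 0" and pt0: "\<And>p. p \<notin> K \<Longrightarrow> \<psi>t p = 0"
    and px0: "\<And>p i. i \<in> Basis \<Longrightarrow> p \<notin> K \<Longrightarrow> \<psi>x i p = 0"
    and pxx0: "\<And>p i. i \<in> Basis \<Longrightarrow> p \<notin> K \<Longrightarrow> \<psi>xx i p = 0"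
  shows "integrable lborel (\<lambda>p. \<psi> p * (wt p - (\<Sum>i\<in>Basis. wxx i p)))" (is "integrable _ ?L")
    and "integrable lborel (\<lambda>p. w p * (- \<psi>t p - (\<Sum>i\<in>Basis. \<psi>xx i p)))" (is "integrable _ ?R")
    and "(\<integral>p. \<psi> p * (wt p - (\<Sum>i\<in>Basis. wxx i p)) \<partial>lborel)
       = (\<integral>p. w p * (- \<psi>t p - (\<Sum>i\<in>Basis. \<psi>xx i p)) \<partial>lborel)"
proof -
  note wx = w[unfolded parabolic_derivs_def, THEN conjunct1, rule_format]
    and wxx = w[unfolded parabolic_derivs_def, THEN conjunct2, THEN conjunct1, rule_format]
    and wt = w[unfolded parabolic_derivs_def, THEN conjunct2, THEN conjunct2, THEN conjunct1, rule_format]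
  have cw: "continuous_on (UNIV \<times> I) w" and cwt: "continuous_on (UNIV \<times> I) wt"
    and cwx: "\<And>i. i \<in> Basis \<Longrightarrow> continuous_on (UNIV \<times> I) (wx i)"
    and cwxx: "\<And>i. i \<in> Basis \<Longrightarrow> continuous_on (UNIV \<times> I) (wxx i)"
    using w unfolding parabolic_derivs_def by blast+
  have px: "\<And>i p. i \<in> Basis \<Longrightarrow> ((\<lambda>h. \<psi> (p + h *\<^sub>R (i, 0))) has_real_derivative \<psi>x i p) (at 0)"
    and pxx: "\<And>i p. i \<in> Basis \<Longrightarrow> ((\<lambda>h. \<psi>x i (p + h *\<^sub>R (i, 0))) has_real_derivative \<psi>xx i p) (at 0)"
    and pt: "\<And>p. ((\<lambda>h. \<psi> (p + h *\<^sub>R (0, 1))) has_real_derivative \<psi>t p) (at 0)"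
    and cp: "continuous_on UNIV \<psi>" and cpt: "continuous_on UNIV \<psi>t"
    and cpx: "\<And>i. i \<in> Basis \<Longrightarrow> continuous_on UNIV (\<psi>x i)"
    and cpxx: "\<And>i. i \<in> Basis \<Longrightarrow> continuous_on UNIV (\<psi>xx i)"
    using \<psi> unfolding parabolic_derivs_def UNIV_Times_UNIV by blast+
  have cl: "closed K" using K(1) by (rule compact_imp_closed)
  have U: "open (UNIV \<times> I :: ('a \<times> real) set)" using I by (simp add: open_Times)
  note glue = continuous_on_UNIV_of_closed_support[OF _ U cl K(2)]
  have inI: "snd p \<in> I" if "p \<in> K" for p using that K(2) by (auto simp: mem_Times_iff)
  have sub: "continuous_on UNIV f \<Longrightarrow> continuous_on (UNIV \<times> I) f" for f :: "'a \<times> real \<Rightarrow> real"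
    by (erule continuous_on_subset) simp
  have cL: "continuous_on UNIV ?L"
    by (rule glue) (use cwt cwxx cp sub p0 in \<open>auto intro!: continuous_intros\<close>)
  have cR: "continuous_on UNIV ?R"
    by (rule glue) (use cw cpt cpxx sub pt0 pxx0 in \<open>auto intro!: continuous_intros\<close>)
  show iL: "integrable lborel ?L"
    by (rule integrable_continuous_compact_support[OF cL K(1)]) (use p0 in auto)
  show iR: "integrable lborel ?R"
    by (rule integrable_continuous_compact_support[OF cR K(1)]) (use pt0 pxx0 in auto)
  define D where "D = (\<lambda>i p. \<psi> p * wxx i p - w p * \<psi>xx i p)"
  define E where "E = (\<lambda>p. \<psi> p * wt p + w p * \<psi>t p)"
  have cD: "continuous_on UNIV (D i)" if "i \<in> Basis" for i
    unfolding D_def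
    by (rule glue) (use cw cwxx cp cpxx sub p0 pxx0 that in \<open>auto intro!: continuous_intros\<close>)
  have cE: "continuous_on UNIV E"
    unfolding E_def
    by (rule glue) (use cw cwt cp cpt sub p0 pt0 in \<open>auto intro!: continuous_intros\<close>)
  have D0: "D i p = 0" if "i \<in> Basis" "p \<notin> K" for i p using that p0 pxx0 by (simp add: D_def)
  have E0: "E p = 0" if "p \<notin> K" for p using that p0 pt0 by (simp add: E_def)
  have iD: "(\<integral>p. D i p \<partial>lborel) = 0" if i: "i \<in> Basis" for i
  proof (rule integral_directional_derivative_eq_0[where e="(i, 0)" and K=K])
    let ?h = "\<lambda>p. \<psi> p * wx i p - w p * \<psi>x i p"
    show "continuous_on UNIV ?h"
      by (rule glue) (use cw cwx cp cpx sub p0 px0 i in \<open>auto intro!: continuous_intros\<close>)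
    show h0: "?h p = 0" if "p \<notin> K" for p using that p0 px0 i by simp
    show "((\<lambda>r. ?h (p + r *\<^sub>R (i, 0))) has_real_derivative D i p) (at 0)" for p
    proof (cases "p \<in> K")
      case True
      show ?thesis
        using DERIV_diff[OF DERIV_mult[OF px[OF i, of p] wxx[OF i inI[OF True]]]
                            DERIV_mult[OF wx[OF i inI[OF True]] pxx[OF i, of p]]]
        by (simp add: D_def zero_prod_def[symmetric] algebra_simps)
    next
      case False
      show ?thesis
        using has_real_derivative_0_off_closed_support[OF cl False, of ?h "(i, 0)", OF h0] D0[OF i False] by simp
    qed
  qed (use cD D0 K i in auto)
  have iE: "(\<integral>p. E p \<partial>lborel) = 0"
  proof (rule integral_directional_derivative_eq_0[where e="(0, 1)" and K=K])
    let ?h = "\<lambda>p. \<psi> p * w p"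
    show "continuous_on UNIV ?h"
      by (rule glue) (use cw cp sub p0 in \<open>auto intro!: continuous_intros\<close>)
    show h0: "?h p = 0" if "p \<notin> K" for p using that p0 by simp
    show "((\<lambda>r. ?h (p + r *\<^sub>R (0, 1))) has_real_derivative E p) (at 0)" for p
    proof (cases "p \<in> K")
      case True
      show ?thesis
        using DERIV_mult[OF pt[of p] wt[OF inI[OF True]]]
        by (simp add: E_def zero_prod_def[symmetric] algebra_simps)
    next
      case False
      show ?thesis
        using has_real_derivative_0_off_closed_support[OF cl False, of ?h "(0, 1)", OF h0] E0[OF False] by simp
    qed
  qed (use cE E0 K in auto)
  have intD: "integrable lborel (D i)" if "i \<in> Basis" for i
    by (rule integrable_continuous_compact_support[OF cD K(1)]) (use that D0 in auto)
  have intE: "integrable lborel E"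
    by (rule integrable_continuous_compact_support[OF cE K(1)]) (use E0 in auto)
  have "(\<integral>p. ?L p \<partial>lborel) - (\<integral>p. ?R p \<partial>lborel) = (\<integral>p. ?L p - ?R p \<partial>lborel)"
    using iL iR by simp
  also have "\<dots> = (\<integral>p. E p - (\<Sum>i\<in>Basis. D i p) \<partial>lborel)"
    by (rule Bochner_Integration.integral_cong)
       (auto simp: E_def D_def sum_subtractf sum_distrib_left algebra_simps)
  also have "\<dots> = 0"
    using intD intE iD iE by (simp add: Bochner_Integration.integral_sum)
  finally show "(\<integral>p. ?L p \<partial>lborel) = (\<integral>p. ?R p \<partial>lborel)" by simp
qed

section \<open>Powers of the heat kernel\<close>

lemma nn_integral_lborel_affine:
  fixes f :: "'b::euclidean_space \<Rightarrow> ennreal"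
  assumes [measurable]: "f \<in> borel_measurable borel" and c: "c \<noteq> 0"
  shows "(\<integral>\<^sup>+x. f x \<partial>lborel) = ennreal (\<bar>c\<bar> ^ DIM('b)) * (\<integral>\<^sup>+x. f (t + c *\<^sub>R x) \<partial>lborel)"
  by (subst lborel_affine[OF c, of t])
     (simp add: nn_integral_density nn_integral_distr nn_integral_cmult)

text \<open>Space and time are scaled by different factors, so Tonelli separates them and each is
  substituted on its own; the Jacobian is \<open>r ^ DIM('a)\<close> times
  \<open>r\<^sup>2\<close>.\<close>

lemma nn_integral_lborel_parabolic_affine:
  fixes f :: "'a::euclidean_space \<times> real \<Rightarrow> ennreal"
  assumes [measurable]: "f \<in> borel_measurable borel" and r: "r > 0"
  shows "(\<integral>\<^sup>+p. f p \<partial>lborel)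
    = ennreal (r powr (real DIM('a) + 2)) * (\<integral>\<^sup>+p. f (x + r *\<^sub>R fst p, t + r\<^sup>2 * snd p) \<partial>lborel)"
proof -
  have meas: "(\<lambda>p. f (x + r *\<^sub>R fst p, t + r\<^sup>2 * snd p)) \<in> borel_measurable (borel \<Otimes>\<^sub>M borel)"
    by measurable
  have [measurable]: "f \<in> borel_measurable (borel \<Otimes>\<^sub>M borel)" by (simp add: borel_prod)
  have "(\<integral>\<^sup>+p. f p \<partial>lborel) = (\<integral>\<^sup>+s. \<integral>\<^sup>+y. f (y, s) \<partial>lborel \<partial>lborel)"
    by (simp add: lborel_prod[symmetric] lborel_pair.nn_integral_snd)
  also have "\<dots> = (\<integral>\<^sup>+s. ennreal (r ^ DIM('a)) * (\<integral>\<^sup>+y. f (x + r *\<^sub>R y, s) \<partial>lborel) \<partial>lborel)"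
    using r by (subst nn_integral_lborel_affine[where c=r and t=x]) auto
  also have "\<dots> = ennreal (r ^ DIM('a)) * (\<integral>\<^sup>+s. \<integral>\<^sup>+y. f (x + r *\<^sub>R y, s) \<partial>lborel \<partial>lborel)"
    by (rule nn_integral_cmult) measurable
  also have "(\<integral>\<^sup>+s. \<integral>\<^sup>+y. f (x + r *\<^sub>R y, s) \<partial>lborel \<partial>lborel)
      = ennreal (r\<^sup>2) * (\<integral>\<^sup>+s. \<integral>\<^sup>+y. f (x + r *\<^sub>R y, t + r\<^sup>2 * s) \<partial>lborel \<partial>lborel)"
    using r by (subst nn_integral_lborel_affine[where c="r\<^sup>2" and t=t]) auto
  also have "(\<integral>\<^sup>+s. \<integral>\<^sup>+y. f (x + r *\<^sub>R y, t + r\<^sup>2 * s) \<partial>lborel \<partial>lborel)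
      = (\<integral>\<^sup>+p. f (x + r *\<^sub>R fst p, t + r\<^sup>2 * snd p) \<partial>lborel)"
    using lborel_pair.nn_integral_snd[of "\<lambda>p. f (x + r *\<^sub>R fst p, t + r\<^sup>2 * snd p)"] meas
    by (simp add: lborel_prod borel_prod)
  finally show ?thesis
    using r by (simp add: mult.assoc[symmetric] ennreal_mult[symmetric] powr_add powr_realpow)
qed

lemma gaussian_nn_integral_finite:
  assumes c: "c > 0"
  shows "(\<integral>\<^sup>+(y::'a::euclidean_space). ennreal (exp (- c * (norm y)\<^sup>2)) \<partial>lborel) < \<infinity>"
proof -
  have n: "(norm y)\<^sup>2 = (\<Sum>b\<in>Basis. (y \<bullet> b)\<^sup>2)" for y :: 'a
    unfolding power2_norm_eq_inner by (subst euclidean_inner) (simp add: power2_eq_square)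
  have "integrable lborel (\<lambda>x. sqrt (2 * pi * (1 / sqrt (2*c))\<^sup>2) * normal_density 0 (1 / sqrt (2*c)) x)"
    using c by simp
  moreover have "sqrt (2 * pi * (1 / sqrt (2*c))\<^sup>2) * normal_density 0 (1 / sqrt (2*c)) x = exp (- c * x\<^sup>2)" for x
    using c by (simp add: normal_density_def power_divide field_simps)
  ultimately have i: "integrable lborel (\<lambda>x::real. exp (- c * x\<^sup>2))" by simp
  have "(\<integral>\<^sup>+(y::'a). ennreal (exp (- c * (norm y)\<^sup>2)) \<partial>lborel)
      = (\<integral>\<^sup>+(y::'a). (\<Prod>b\<in>Basis. ennreal (exp (- c * (y \<bullet> b)\<^sup>2))) \<partial>lborel)"
    by (simp add: n sum_distrib_left exp_sum prod_ennreal sum_negf[symmetric])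
  also have "\<dots> = (\<Prod>b\<in>(Basis::'a set). (\<integral>\<^sup>+x. ennreal (exp (- c * x\<^sup>2)) \<partial>lborel))"
    by (rule nn_integral_lborel_prod) auto
  also have "\<dots> = (\<Prod>b\<in>(Basis::'a set). ennreal (\<integral>x. exp (- c * x\<^sup>2) \<partial>lborel))"
    using i by (subst nn_integral_eq_integral) auto
  also have "\<dots> < \<infinity>" by (simp add: power_less_top_ennreal)
  finally show ?thesis .
qed

lemma heat_kernel_powr:
  fixes y :: "'a::euclidean_space"
  assumes "\<tau> > 0"
  shows "heat_kernel y \<tau> powr (a / real DIM('a))
    = (4 * pi * \<tau>) powr (- a / 2) * exp (- (a / (4 * real DIM('a))) * (norm y)\<^sup>2 / \<tau>)"
  using assms by (simp add: heat_kernel_def powr_mult powr_powr exp_powr_real field_simps)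

lemma heat_kernel_powr_measurable [measurable]:
  "(\<lambda>p::'a::euclidean_space \<times> real. heat_kernel (fst p) (snd p) powr b) \<in> borel_measurable borel"
proof -
  have "(\<lambda>p::'a::euclidean_space \<times> real. heat_kernel (fst p) (snd p) powr b) \<in> borel_measurable (borel \<Otimes>\<^sub>M borel)"
    unfolding heat_kernel_def by measurable
  then show ?thesis by (simp add: borel_prod)
qed

lemma indicator_heat_kernel_powr_measurable:
  assumes "A \<in> sets borel"
  shows "(\<lambda>p::'a::euclidean_space \<times> real. indicator A p * ennreal (heat_kernel (fst p) (snd p) powr b))
    \<in> borel_measurable borel"
  using heat_kernel_powr_measurable[of b, where 'a='a] assms
  by (intro borel_measurable_times_ennreal borel_measurable_indicator measurable_compose[OF _ measurable_ennreal])

text \<open>Substituting \<open>y = sqrt \<tau> z\<close> shows that the spatial integral is a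
  constant times \<open>\<tau> powr ((n-a)/2)\<close>. This exponent exceeds -1 exactly when
  \<open>a < n + 2\<close>, which makes the time integral up to \<open>R\<^sup>2\<close> converge
  and produces the power \<open>n + 2 - a\<close> of \<open>R\<close>.\<close>

lemma heat_kernel_powr_nn_integral:
  assumes a: "0 < a" "a < real DIM('a) + 2"
  obtains C where "C \<ge> 0" "\<And>R. R > 0 \<Longrightarrow>
    (\<integral>\<^sup>+(p::'a::euclidean_space \<times> real). indicator (UNIV \<times> {0<..<R\<^sup>2}) p *
       ennreal (heat_kernel (fst p) (snd p) powr (a / real DIM('a))) \<partial>lborel)
    \<le> ennreal (C * R powr (real DIM('a) + 2 - a))"
proof -
  define n where "n = real DIM('a)"
  have n: "n > 0" by (simp add: n_def)
  define c where "c = a / (4 * n)"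
  have c: "c > 0" using a n by (simp add: c_def)
  define \<Gamma> where "\<Gamma> = enn2real (\<integral>\<^sup>+(y::'a). ennreal (exp (- c * (norm y)\<^sup>2)) \<partial>lborel)"
  have \<Gamma>: "(\<integral>\<^sup>+(y::'a). ennreal (exp (- c * (norm y)\<^sup>2)) \<partial>lborel) = ennreal \<Gamma>"
    using gaussian_nn_integral_finite[OF c, where 'a='a] unfolding \<Gamma>_def by simp
  have \<Gamma>0: "\<Gamma> \<ge> 0" by (simp add: \<Gamma>_def)
  define C where "C = (4*pi) powr (-a/2) * \<Gamma> / ((n-a)/2 + 1)"
  have e: "(n-a)/2 + 1 > 0" "(n-a)/2 > -1" using a by (auto simp: n_def field_simps)
  have C: "C \<ge> 0" unfolding C_def using \<Gamma>0 e(1) by (intro divide_nonneg_pos mult_nonneg_nonneg) auto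
  have inner: "(\<integral>\<^sup>+(y::'a). ennreal (heat_kernel y \<tau> powr (a / n)) \<partial>lborel)
      = ennreal ((4*pi) powr (-a/2) * \<Gamma> * \<tau> powr ((n-a)/2))" if \<tau>: "\<tau> > 0" for \<tau>
  proof -
    have "(\<integral>\<^sup>+(y::'a). ennreal (heat_kernel y \<tau> powr (a / n)) \<partial>lborel)
        = (\<integral>\<^sup>+(y::'a). ennreal ((4 * pi * \<tau>) powr (- a / 2)) * ennreal (exp (- c * (norm y)\<^sup>2 / \<tau>)) \<partial>lborel)"
      using \<tau> by (simp add: n_def heat_kernel_powr c_def ennreal_mult)
    also have "\<dots> = ennreal ((4 * pi * \<tau>) powr (- a / 2)) * (\<integral>\<^sup>+(y::'a). ennreal (exp (- c * (norm y)\<^sup>2 / \<tau>)) \<partial>lborel)"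
      by (rule nn_integral_cmult) measurable
    also have "(\<integral>\<^sup>+(y::'a). ennreal (exp (- c * (norm y)\<^sup>2 / \<tau>)) \<partial>lborel)
        = ennreal (sqrt \<tau> ^ DIM('a)) * (\<integral>\<^sup>+(y::'a). ennreal (exp (- c * (norm (sqrt \<tau> *\<^sub>R y))\<^sup>2 / \<tau>)) \<partial>lborel)"
      using \<tau> by (subst nn_integral_lborel_affine[where c="sqrt \<tau>" and t=0]) auto
    also have "(\<integral>\<^sup>+(y::'a). ennreal (exp (- c * (norm (sqrt \<tau> *\<^sub>R y))\<^sup>2 / \<tau>)) \<partial>lborel) = ennreal \<Gamma>"
      using \<tau> \<Gamma> by (simp add: power_mult_distrib)
    also have "sqrt \<tau> ^ DIM('a) = \<tau> powr (n/2)"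
      using \<tau> by (simp add: n_def powr_half_sqrt[symmetric] powr_realpow[symmetric] powr_powr)
    also have "ennreal ((4 * pi * \<tau>) powr (- a / 2)) * (ennreal (\<tau> powr (n/2)) * ennreal \<Gamma>)
        = ennreal ((4*pi) powr (-a/2) * \<Gamma> * (\<tau> powr (-a/2) * \<tau> powr (n/2)))"
      using \<tau> \<Gamma>0 by (simp add: ennreal_mult[symmetric] powr_mult mult_ac)
    also have "\<tau> powr (-a/2) * \<tau> powr (n/2) = \<tau> powr ((n-a)/2)"
      by (simp add: powr_add[symmetric] diff_divide_distrib)
    finally show ?thesis .
  qed
  show thesis
  proof (rule that[OF C])
    fix R :: real assume R: "R > 0"
    have m: "(\<lambda>p::'a \<times> real. indicator (UNIV \<times> {0<..<R\<^sup>2}) p * ennreal (heat_kernel (fst p) (snd p) powr (a / n)))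
        \<in> borel_measurable (lborel \<Otimes>\<^sub>M lborel)"
      unfolding lborel_prod
      using indicator_heat_kernel_powr_measurable[of "UNIV \<times> {0<..<R\<^sup>2} :: ('a \<times> real) set" "a / n"]
      by (simp add: borel_open open_Times)
    have "(\<integral>\<^sup>+(p::'a \<times> real). indicator (UNIV \<times> {0<..<R\<^sup>2}) p * ennreal (heat_kernel (fst p) (snd p) powr (a / n)) \<partial>lborel)
       = (\<integral>\<^sup>+\<tau>. \<integral>\<^sup>+(y::'a). indicator (UNIV \<times> {0<..<R\<^sup>2}) (y, \<tau>) * ennreal (heat_kernel y \<tau> powr (a / n)) \<partial>lborel \<partial>lborel)"
      using lborel_pair.nn_integral_snd[OF m] by (simp add: lborel_prod)
    also have "\<dots> \<le> (\<integral>\<^sup>+\<tau>. ennreal ((4*pi) powr (-a/2) * \<Gamma>) * (ennreal (\<tau> powr ((n-a)/2)) * indicator {0..R\<^sup>2} \<tau>) \<partial>lborel)"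
    proof (rule nn_integral_mono)
      fix \<tau> :: real
      show "(\<integral>\<^sup>+(y::'a). indicator (UNIV \<times> {0<..<R\<^sup>2}) (y, \<tau>) * ennreal (heat_kernel y \<tau> powr (a / n)) \<partial>lborel)
        \<le> ennreal ((4*pi) powr (-a/2) * \<Gamma>) * (ennreal (\<tau> powr ((n-a)/2)) * indicator {0..R\<^sup>2} \<tau>)"
      proof (cases "\<tau> \<in> {0<..<R\<^sup>2}")
        case True
        then show ?thesis using inner[of \<tau>] \<Gamma>0 by (simp add: ennreal_mult)
      qed simp
    qed
    also have "\<dots> = ennreal ((4*pi) powr (-a/2) * \<Gamma>) * (\<integral>\<^sup>+\<tau>. ennreal (\<tau> powr ((n-a)/2)) * indicator {0..R\<^sup>2} \<tau> \<partial>lborel)"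
      by (rule nn_integral_cmult) measurable
    also have "(\<integral>\<^sup>+\<tau>. ennreal (\<tau> powr ((n-a)/2)) * indicator {0..R\<^sup>2} \<tau> \<partial>lborel)
        = ennreal ((R\<^sup>2) powr ((n-a)/2+1) / ((n-a)/2+1))"
      by (rule nn_integral_has_integral_lebesgue'[OF _ has_integral_powr_from_0]) (use e in auto)
    also have "(R\<^sup>2) powr ((n-a)/2+1) = R powr (n + 2 - a)"
    proof -
      have "R\<^sup>2 = R powr 2" using R by simp
      then have "(R\<^sup>2) powr ((n-a)/2+1) = R powr (2 * ((n-a)/2+1))" by (simp only: powr_powr)
      also have "2 * ((n-a)/2+1) = n + 2 - a" by simp
      finally show ?thesis .
    qed
    also have "ennreal ((4*pi) powr (-a/2) * \<Gamma>) * ennreal (R powr (n + 2 - a) / ((n-a)/2+1)) = ennreal (C * R powr (n + 2 - a))"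
    proof -
      have "0 \<le> R powr (n + 2 - a) / ((n-a)/2+1)" using e(1) by (intro divide_nonneg_pos) auto
      then show ?thesis using \<Gamma>0 by (subst ennreal_mult[symmetric]) (auto simp: C_def)
    qed
    finally show "(\<integral>\<^sup>+(p::'a \<times> real). indicator (UNIV \<times> {0<..<R\<^sup>2}) p *
       ennreal (heat_kernel (fst p) (snd p) powr (a / real DIM('a))) \<partial>lborel)
    \<le> ennreal (C * R powr (real DIM('a) + 2 - a))" by (simp add: n_def)
  qed
qed

section \<open>The mean value inequality for subsolutions\<close>

text \<open>The left side is largest at \<open>x = k / c\<close>. Using \<open>ln z \<le> z\<close>
  at \<open>z = x * c / k\<close> instead of maximising loses only the factor
  \<open>exp (- k)\<close>.\<close>

lemma powr_times_exp_bound: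
  fixes k c x :: real
  assumes "k > 0" "c > 0" "x > 0"
  shows "x powr k * exp (- c * x) \<le> (k / c) powr k"
proof -
  have "ln (x * c / k) \<le> x * c / k"
    using assms ln_le_minus_one[of "x * c / k"] by simp
  then have "k * ln (x * c / k) \<le> c * x"
    using assms by (simp add: field_simps)
  then have "(x * c / k) powr k \<le> exp (c * x)"
    using assms by (simp add: powr_def)
  then have "(x * c / k) powr k * (k / c) powr k \<le> exp (c * x) * (k / c) powr k"
    by (rule mult_right_mono) simp
  moreover have "(x * c / k) powr k * (k / c) powr k = x powr k"
    using assms by (simp add: powr_mult[symmetric])
  ultimately show ?thesis by (simp add: exp_minus field_simps)
qed

text \<open>Summed over the basis, the second formula is the Laplacian of a radial function,
  \<open>2 n F1 + 4 q F2\<close> at \<open>q = (norm y)\<^sup>2\<close>.\<close>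

lemma has_real_derivative_radial:
  fixes y i :: "'a::euclidean_space"
  assumes i: "i \<in> Basis" and F: "\<And>q. (F has_real_derivative F1 q) (at q)"
    and F1: "\<And>q. (F1 has_real_derivative F2 q) (at q)"
  shows "((\<lambda>h. F ((norm (y + h *\<^sub>R i))\<^sup>2)) has_real_derivative 2 * (y \<bullet> i) * F1 ((norm y)\<^sup>2)) (at 0)"
    and "((\<lambda>h. 2 * ((y + h *\<^sub>R i) \<bullet> i) * F1 ((norm (y + h *\<^sub>R i))\<^sup>2)) has_real_derivative
           2 * F1 ((norm y)\<^sup>2) + 4 * (y \<bullet> i)\<^sup>2 * F2 ((norm y)\<^sup>2)) (at 0)"
proof -
  have q: "(norm (y + h *\<^sub>R i))\<^sup>2 = (norm y)\<^sup>2 + 2 * (y \<bullet> i) * h + h\<^sup>2" for h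
    using i by (simp only: power2_norm_eq_inner)
      (simp add: inner_add_left inner_add_right inner_commute power2_eq_square)
  have l: "(y + h *\<^sub>R i) \<bullet> i = y \<bullet> i + h" for h
    using i by (simp add: inner_add_left)
  have dq: "((\<lambda>h. (norm y)\<^sup>2 + 2 * (y \<bullet> i) * h + h\<^sup>2) has_real_derivative 2 * (y \<bullet> i)) (at 0)"
    by (auto intro!: derivative_eq_intros)
  show "((\<lambda>h. F ((norm (y + h *\<^sub>R i))\<^sup>2)) has_real_derivative 2 * (y \<bullet> i) * F1 ((norm y)\<^sup>2)) (at 0)"
    unfolding q using DERIV_chain2[of F _ "\<lambda>h. (norm y)\<^sup>2 + 2 * (y \<bullet> i) * h + h\<^sup>2", OF _ dq] F
    by (simp add: mult.commute)
  have a: "((\<lambda>h. F1 ((norm y)\<^sup>2 + 2 * (y \<bullet> i) * h + h\<^sup>2)) has_real_derivative F2 ((norm y)\<^sup>2) * (2 * (y \<bullet> i))) (at 0)"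
    using DERIV_chain2[of F1 _ "\<lambda>h. (norm y)\<^sup>2 + 2 * (y \<bullet> i) * h + h\<^sup>2", OF _ dq] F1 by simp
  have b: "((\<lambda>h. 2 * (y \<bullet> i + h)) has_real_derivative 2) (at 0)"
    by (auto intro!: derivative_eq_intros)
  show "((\<lambda>h. 2 * ((y + h *\<^sub>R i) \<bullet> i) * F1 ((norm (y + h *\<^sub>R i))\<^sup>2)) has_real_derivative
           2 * F1 ((norm y)\<^sup>2) + 4 * (y \<bullet> i)\<^sup>2 * F2 ((norm y)\<^sup>2)) (at 0)"
    unfolding q l by (rule DERIV_cong[OF DERIV_mult[OF b a]]) (simp add: power2_eq_square)
qed

text \<open>With \<open>\<tau> = -s\<close> the test function is
  \<open>\<psi> = (1 - \<eta>(\<tau>/\<delta>)) \<eta>(\<tau>) \<eta>(|y|\<^sup>2) \<tau>\<^sup>-\<^sup>n\<^sup>/\<^sup>2 exp(-|y|\<^sup>2/(4\<tau>))\<close>. The derivative of the first factor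
  approximates a Dirac mass at the origin as \<open>\<delta> \<rightarrow> 0\<close>; all other terms of \<open>-\<psi>\<^sub>t - \<Delta>\<psi>\<close> live away from the
  origin and are bounded uniformly in \<open>\<delta>\<close>.\<close>

lemma heat_test_function:
  obtains C c :: real where "C > 0" "c > 0"
    "\<And>\<delta>. 0 < \<delta> \<Longrightarrow> \<delta> \<le> 1/2 \<Longrightarrow>
      \<exists>(\<psi> :: 'a::euclidean_space \<times> real \<Rightarrow> real) \<psi>x \<psi>xx \<psi>t. parabolic_derivs UNIV \<psi> \<psi>x \<psi>xx \<psi>t \<and>
        (\<forall>p. p \<notin> cball 0 1 \<times> {-1..-\<delta>/2} \<longrightarrow>
           \<psi> p = 0 \<and> \<psi>t p = 0 \<and> (\<forall>i\<in>Basis. \<psi>x i p = 0 \<and> \<psi>xx i p = 0)) \<and>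
        (\<forall>p. 0 \<le> \<psi> p) \<and> (\<integral>p. \<psi> p \<partial>lborel) \<le> C \<and>
        (\<forall>p. c * \<delta> powr (- real DIM('a) / 2 - 1) * indicator (cball 0 (sqrt (\<delta>/2)) \<times> {-8*\<delta>/10..-7*\<delta>/10}) p
             - C * indicator (cball 0 1 \<times> {-1..0}) p
           \<le> - \<psi>t p - (\<Sum>i\<in>Basis. \<psi>xx i p))"
proof -
  define n where "n = real DIM('a)"
  define m where "m = n / 2"
  have n: "n > 0" and m: "m > 0" by (auto simp: n_def m_def)
  obtain \<eta> \<eta>1 \<eta>2 B where
    d1: "\<And>x. (\<eta> has_real_derivative \<eta>1 x) (at x)" and d2: "\<And>x. (\<eta>1 has_real_derivative \<eta>2 x) (at x)"
    and c2: "continuous_on UNIV \<eta>2"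
    and \<eta>0: "\<And>x. 0 \<le> \<eta> x" and \<eta>le: "\<And>x. \<eta> x \<le> 1" and \<eta>1le: "\<And>x. \<eta>1 x \<le> 0"
    and \<eta>one: "\<And>x. x \<le> 1/2 \<Longrightarrow> \<eta> x = 1" and \<eta>zero: "\<And>x. 1 \<le> x \<Longrightarrow> \<eta> x = 0"
    and \<eta>10: "\<And>x. x \<le> 1/2 \<or> 1 \<le> x \<Longrightarrow> \<eta>1 x = 0" and \<eta>20: "\<And>x. x \<le> 1/2 \<or> 1 \<le> x \<Longrightarrow> \<eta>2 x = 0"
    and B1: "\<And>x. \<bar>\<eta>1 x\<bar> \<le> B" and B2: "\<And>x. \<bar>\<eta>2 x\<bar> \<le> B"
    and low: "\<And>x. 7/10 \<le> x \<Longrightarrow> x \<le> 8/10 \<Longrightarrow> 1 \<le> - \<eta>1 x"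
    by (rule cutoff_function_exists) blast
  have B: "B \<ge> 0" using B1[of 0] by linarith
  have c\<eta>: "continuous_on UNIV \<eta>" using d1 by (meson DERIV_continuous_on has_field_derivative_at_within)
  have c1: "continuous_on UNIV \<eta>1" using d2 by (meson DERIV_continuous_on has_field_derivative_at_within)
  have cc: "continuous_on S f \<Longrightarrow> continuous_on S (\<lambda>x. \<eta> (f x))"
    "continuous_on S f \<Longrightarrow> continuous_on S (\<lambda>x. \<eta>1 (f x))"
    "continuous_on S f \<Longrightarrow> continuous_on S (\<lambda>x. \<eta>2 (f x))" for S :: "('a \<times> real) set" and f
    using continuous_on_compose2[OF c\<eta>] continuous_on_compose2[OF c1] continuous_on_compose2[OF c2] by auto
  obtain Ck where Ck: "Ck \<ge> 0" "\<And>R. R > 0 \<Longrightarrow>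
    (\<integral>\<^sup>+(p::'a \<times> real). indicator (UNIV \<times> {0<..<R\<^sup>2}) p *
       ennreal (heat_kernel (fst p) (snd p) powr (n / n)) \<partial>lborel)
    \<le> ennreal (Ck * R powr (n + 2 - n))"
    by (rule heat_kernel_powr_nn_integral[of n, where 'a='a]) (use n in \<open>auto simp: n_def\<close>)
  \<comment> \<open>Where derivatives of the spatial cutoff are nonzero,
    \<open>(norm y)\<^sup>2\<close> exceeds 1/2, so the kernel divided by \<open>\<tau>\<close> is
    at most \<open>\<tau> powr (- m - 1) * exp (- 1 / (8 * \<tau>))\<close>. \<open>S\<close> bounds
    this for all \<open>\<tau>\<close>, by \<open>powr_times_exp_bound\<close> in the variable
    \<open>1 / \<tau>\<close>.\<close>
  define S where "S = (8 * (m + 1)) powr (m + 1)"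
  have S: "\<tau> powr (- m) * exp (- (1/2) / (4 * \<tau>)) / \<tau> \<le> S" if "\<tau> > 0" for \<tau>
    using powr_times_exp_bound[of "m + 1" "1/8" "1 / \<tau>"] that m
    by (simp add: S_def powr_divide powr_minus powr_add field_simps)
  \<comment> \<open>The summands bound, in order, the mass of \<open>\<psi>\<close>, the effect of
    the time cutoff on [1/2, 1] and that of the spatial cutoff; the final 1 makes \<open>C\<close>
    positive.\<close>
  define C where "C = (4*pi) powr m * Ck + B * 2 powr m + (2*n + 6) * B * S + 1"
  have S0: "S \<ge> 0" by (simp add: S_def)
  have C1: "(4*pi) powr m * Ck \<le> C" and C2: "B * 2 powr m + (2*n + 6) * B * S \<le> C" and C0: "C > 0"
    using Ck(1) B S0 n by (auto simp: C_def intro!: add_nonneg_pos add_nonneg_nonneg)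
  have main: "\<exists>(\<psi> :: 'a \<times> real \<Rightarrow> real) \<psi>x \<psi>xx \<psi>t. parabolic_derivs UNIV \<psi> \<psi>x \<psi>xx \<psi>t \<and>
        (\<forall>p. p \<notin> cball 0 1 \<times> {-1..-\<delta>/2} \<longrightarrow>
           \<psi> p = 0 \<and> \<psi>t p = 0 \<and> (\<forall>i\<in>Basis. \<psi>x i p = 0 \<and> \<psi>xx i p = 0)) \<and>
        (\<forall>p. 0 \<le> \<psi> p) \<and> (\<integral>p. \<psi> p \<partial>lborel) \<le> C \<and>
        (\<forall>p. exp (-1/4) * \<delta> powr (- real DIM('a) / 2 - 1) * indicator (cball 0 (sqrt (\<delta>/2)) \<times> {-8*\<delta>/10..-7*\<delta>/10}) p
             - C * indicator (cball 0 1 \<times> {-1..0}) p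
           \<le> - \<psi>t p - (\<Sum>i\<in>Basis. \<psi>xx i p))"
    if \<delta>: "0 < \<delta>" "\<delta> \<le> 1/2" for \<delta>
  proof -
    define \<kappa> where "\<kappa> = (\<lambda>\<tau>. (1 - \<eta> (\<tau>/\<delta>)) * \<eta> \<tau>)"
    define \<kappa>1 where "\<kappa>1 = (\<lambda>\<tau>. - (\<eta>1 (\<tau>/\<delta>) / \<delta>) * \<eta> \<tau> + (1 - \<eta> (\<tau>/\<delta>)) * \<eta>1 \<tau>)"
    \<comment> \<open>The backward heat kernel with pole at the origin, without its constant
      \<open>(4*pi) powr (- m)\<close>. For negative times \<open>- G_t - \<Delta>G = 0\<close>, so
      only terms with a derivative of a cutoff will survive.\<close>
    define G where "G = (\<lambda>p::'a \<times> real. (- snd p) powr (- m) * exp (- (norm (fst p))\<^sup>2 / (4 * (- snd p))))"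
    define k where "k = (\<lambda>p::'a \<times> real. 1 / (4 * (- snd p)))"
    define q where "q = (\<lambda>p::'a \<times> real. (norm (fst p))\<^sup>2)"
    define \<psi> where "\<psi> = (\<lambda>p. \<kappa> (- snd p) * G p * \<eta> (q p))"
    define \<psi>x where "\<psi>x = (\<lambda>i p. \<kappa> (- snd p) * G p * (2 * (fst p \<bullet> i) * (\<eta>1 (q p) - k p * \<eta> (q p))))"
    define \<psi>xx where "\<psi>xx = (\<lambda>i p. \<kappa> (- snd p) * G p * (2 * (\<eta>1 (q p) - k p * \<eta> (q p))
         + 4 * (fst p \<bullet> i)\<^sup>2 * (\<eta>2 (q p) - 2 * k p * \<eta>1 (q p) + (k p)\<^sup>2 * \<eta> (q p))))"
    define \<psi>t where "\<psi>t = (\<lambda>p. - (G p * \<eta> (q p) *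
         (\<kappa>1 (- snd p) - \<kappa> (- snd p) * (2 * n * k p) + \<kappa> (- snd p) * (4 * q p * (k p)\<^sup>2))))"
    define K where "K = cball (0::'a) 1 \<times> {-1..-\<delta>/2}"
    have d\<kappa>: "(\<kappa> has_real_derivative \<kappa>1 \<tau>) (at \<tau>)" for \<tau>
    proof -
      have "((\<lambda>\<tau>. \<tau>/\<delta>) has_real_derivative 1/\<delta>) (at \<tau>)" using \<delta> by (auto intro!: derivative_eq_intros)
      from DERIV_chain2[OF d1 this]
      have "((\<lambda>\<tau>. \<eta> (\<tau>/\<delta>)) has_real_derivative \<eta>1 (\<tau>/\<delta>) / \<delta>) (at \<tau>)" by simp
      from DERIV_mult[OF DERIV_diff[OF DERIV_const[of 1] this] d1[of \<tau>]]
      show ?thesis unfolding \<kappa>_def \<kappa>1_def by (simp add: algebra_simps)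
    qed
    have \<kappa>0: "\<kappa> \<tau> = 0" "\<kappa>1 \<tau> = 0" if "\<tau> \<le> \<delta>/2 \<or> \<tau> \<ge> 1" for \<tau>
      using that \<delta> \<eta>one[of "\<tau>/\<delta>"] \<eta>10[of "\<tau>/\<delta>"] \<eta>zero[of \<tau>] \<eta>10[of \<tau>]
      by (auto simp: \<kappa>_def \<kappa>1_def field_simps)
    have \<kappa>nn: "0 \<le> \<kappa> \<tau>" "\<kappa> \<tau> \<le> 1" for \<tau>
      using \<eta>0 \<eta>le by (auto simp: \<kappa>_def mult_le_one)
    have sup0: "\<psi> p = 0 \<and> \<psi>t p = 0 \<and> (\<forall>i\<in>Basis. \<psi>x i p = 0 \<and> \<psi>xx i p = 0)" if "p \<notin> K" for p
    proof -
      have "norm (fst p) > 1 \<or> - snd p \<le> \<delta>/2 \<or> - snd p \<ge> 1"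
        using that by (auto simp: K_def mem_Times_iff)
      then consider "norm (fst p) > 1" | "- snd p \<le> \<delta>/2 \<or> - snd p \<ge> 1"
        by blast
      then show ?thesis
      proof cases
        case 1
        then have "q p \<ge> 1" by (simp add: q_def)
        then show ?thesis using \<eta>zero \<eta>10 \<eta>20 by (simp add: \<psi>_def \<psi>x_def \<psi>xx_def \<psi>t_def)
      next
        case 2
        then show ?thesis using \<kappa>0 by (simp add: \<psi>_def \<psi>x_def \<psi>xx_def \<psi>t_def)
      qed
    qed
    have Kc: "compact K" by (simp add: K_def compact_Times)
    have Kcl: "closed K" using Kc by (rule compact_imp_closed)
    have U: "open (UNIV \<times> {..<0} :: ('a \<times> real) set)" by (simp add: open_Times)
    have KU: "K \<subseteq> UNIV \<times> {..<0}" using \<delta> by (auto simp: K_def)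
    note glue = continuous_on_UNIV_of_closed_support[OF _ U Kcl KU]
    have cG: "continuous_on (UNIV \<times> {..<0}) G" "continuous_on (UNIV \<times> {..<0}) k" "continuous_on (UNIV \<times> {..<0}) q"
      unfolding G_def k_def q_def by (intro continuous_intros; force)+
    have c\<kappa>: "continuous_on (UNIV \<times> {..<0}) (\<lambda>p::'a \<times> real. \<kappa> (- snd p))"
      "continuous_on (UNIV \<times> {..<0}) (\<lambda>p::'a \<times> real. \<kappa>1 (- snd p))"
      unfolding \<kappa>_def \<kappa>1_def using \<delta> by (auto intro!: continuous_intros cc)
    have cont: "continuous_on UNIV \<psi>" "continuous_on UNIV \<psi>t" "continuous_on UNIV (\<psi>x i)" "continuous_on UNIV (\<psi>xx i)"
      if "i \<in> Basis" for i
    proof -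
      show "continuous_on UNIV \<psi>"
        by (rule glue) (use sup0 in \<open>auto simp: \<psi>_def intro!: continuous_intros cc cG c\<kappa>\<close>)
      show "continuous_on UNIV \<psi>t"
        by (rule glue) (use sup0 in \<open>auto simp: \<psi>t_def intro!: continuous_intros cc cG c\<kappa>\<close>)
      show "continuous_on UNIV (\<psi>x i)"
        by (rule glue) (use sup0 that in \<open>auto simp: \<psi>x_def intro!: continuous_intros cc cG c\<kappa>\<close>)
      show "continuous_on UNIV (\<psi>xx i)"
        by (rule glue) (use sup0 that in \<open>auto simp: \<psi>xx_def intro!: continuous_intros cc cG c\<kappa>\<close>)
    qed
    have dx: "((\<lambda>h. \<psi> (p + h *\<^sub>R (i, 0))) has_real_derivative \<psi>x i p) (at 0)"
      and dxx: "((\<lambda>h. \<psi>x i (p + h *\<^sub>R (i, 0))) has_real_derivative \<psi>xx i p) (at 0)" if i: "i \<in> Basis" for i p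
    proof -
      obtain y s where p: "p = (y, s)" by (cases p)
      \<comment> \<open>At a fixed time \<open>\<psi>\<close> is a constant times a function of the
        squared norm, so the radial formulas apply.\<close>
      define c where "c = 1 / (4 * (- s))"
      define a where "a = \<kappa> (- s) * (- s) powr (- m)"
      define F where "F = (\<lambda>q. exp (- c * q) * \<eta> q)"
      define F1 where "F1 = (\<lambda>q. exp (- c * q) * (\<eta>1 q - c * \<eta> q))"
      define F2 where "F2 = (\<lambda>q. exp (- c * q) * (\<eta>2 q - 2 * c * \<eta>1 q + c\<^sup>2 * \<eta> q))"
      have F: "(F has_real_derivative F1 q) (at q)" for q
        unfolding F_def F1_def
        by (rule derivative_eq_intros d1 refl | simp)+ (simp add: algebra_simps)
      have F1: "(F1 has_real_derivative F2 q) (at q)" for q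
        unfolding F1_def F2_def
        by (rule derivative_eq_intros d1 d2 refl | simp)+ (simp add: algebra_simps power2_eq_square)
      have e1: "\<psi> (y + h *\<^sub>R i, s) = a * F ((norm (y + h *\<^sub>R i))\<^sup>2)" for h
        by (simp add: \<psi>_def G_def q_def a_def F_def c_def)
      have e2: "\<psi>x i (y + h *\<^sub>R i, s) = a * (2 * ((y + h *\<^sub>R i) \<bullet> i) * F1 ((norm (y + h *\<^sub>R i))\<^sup>2))" for h
        by (simp add: \<psi>x_def G_def q_def k_def a_def F1_def c_def)
      have e3: "\<psi>xx i (y, s) = a * (2 * F1 ((norm y)\<^sup>2) + 4 * (y \<bullet> i)\<^sup>2 * F2 ((norm y)\<^sup>2))"
        by (simp add: \<psi>xx_def G_def q_def k_def a_def F1_def F2_def c_def algebra_simps)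
      show "((\<lambda>h. \<psi> (p + h *\<^sub>R (i, 0))) has_real_derivative \<psi>x i p) (at 0)"
        using DERIV_cmult[OF has_real_derivative_radial(1)[OF i F F1, of y], of a] e2[of 0]
        by (simp add: p e1)
      show "((\<lambda>h. \<psi>x i (p + h *\<^sub>R (i, 0))) has_real_derivative \<psi>xx i p) (at 0)"
        using DERIV_cmult[OF has_real_derivative_radial(2)[OF i F F1, of y], of a] e3
        by (simp add: p e2)
    qed
    have dt: "((\<lambda>h. \<psi> (p + h *\<^sub>R (0, 1))) has_real_derivative \<psi>t p) (at 0)" for p
    proof (cases "p \<in> K")
      case False
      then show ?thesis
        using has_real_derivative_0_off_closed_support[OF Kcl False, of \<psi> "(0, 1)"] sup0 by simp
    next
      case True
      obtain y s where p: "p = (y, s)" by (cases p)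
      have s: "s < 0" using True KU p by auto
      have e1: "((\<lambda>h. \<kappa> (- (s + h))) has_real_derivative \<kappa>1 (- s) * (-1)) (at 0)"
        by (rule DERIV_chain2[where f=\<kappa> and g="\<lambda>h. - (s + h)"]) (use d\<kappa>[of "-s"] in \<open>auto intro!: derivative_eq_intros\<close>)
      have e2: "((\<lambda>h. (- (s + h)) powr (- m)) has_real_derivative (- s) powr (- m) * (2 * n * (1 / (4 * (- s))))) (at 0)"
      proof (rule DERIV_cong)
        show "((\<lambda>h. (- (s + h)) powr (- m)) has_real_derivative - m * (- s) powr (- m - 1) * (- 1)) (at 0)"
          using s by (auto intro!: derivative_eq_intros)
        show "- m * (- s) powr (- m - 1) * (- 1) = (- s) powr (- m) * (2 * n * (1 / (4 * (- s))))"
          using s by (simp add: powr_diff m_def)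
      qed
      have e3: "((\<lambda>h. exp (- (norm y)\<^sup>2 / (4 * (- (s + h))))) has_real_derivative
          exp (- (norm y)\<^sup>2 / (4 * (- s))) * (- (4 * (norm y)\<^sup>2 * (1 / (4 * (- s)))\<^sup>2))) (at 0)"
        using s by (auto intro!: derivative_eq_intros simp: field_simps power2_eq_square)
      have "((\<lambda>h. \<kappa> (- (s + h)) * ((- (s + h)) powr (- m) * exp (- (norm y)\<^sup>2 / (4 * (- (s + h))))) * \<eta> ((norm y)\<^sup>2))
          has_real_derivative \<psi>t p) (at 0)"
        by (rule DERIV_cong[OF DERIV_cmult_right[OF DERIV_mult[OF e1 DERIV_mult[OF e2 e3]]]])
           (simp add: p \<psi>t_def G_def q_def k_def algebra_simps)
      then show ?thesis
        by (simp only: p \<psi>_def G_def q_def add_Pair scaleR_Pair fst_conv snd_conv scaleR_zero_right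
            add_0_right real_scaleR_def mult_1_right)
    qed
    have pd: "parabolic_derivs UNIV \<psi> \<psi>x \<psi>xx \<psi>t"
      unfolding parabolic_derivs_def UNIV_Times_UNIV using cont dx dxx dt SOME_Basis by blast
    have Gnn: "0 \<le> G p" for p by (simp add: G_def)
    have nn: "0 \<le> \<psi> p" for p using \<kappa>nn \<eta>0 Gnn by (simp add: \<psi>_def)
    have int: "(\<integral>p. \<psi> p \<partial>lborel) \<le> C"
    proof -
      \<comment> \<open>The reflection of \<open>p\<close> to \<open>- p\<close> turns the backward
        kernel into the heat kernel. The exponent \<open>n/n\<close> is 1, written so that the
        integral bound for kernel powers applies with \<open>a = n\<close> and
        \<open>R = 1\<close>.\<close>
      have m1: "(\<lambda>p::'a \<times> real. indicator (UNIV \<times> {0<..<1}) p * ennreal (heat_kernel (fst p) (snd p) powr (n/n)))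
          \<in> borel_measurable borel"
        by (rule indicator_heat_kernel_powr_measurable) (auto intro!: borel_open open_Times)
      have m2: "(\<lambda>p::'a \<times> real. indicator (UNIV \<times> {0<..<1}) (-p) * ennreal (heat_kernel (fst (-p)) (snd (-p)) powr (n/n)))
          \<in> borel_measurable lborel"
        using measurable_compose[OF borel_measurable_uminus m1, of "\<lambda>p. p" lborel] by simp
      have le: "ennreal (\<psi> p) \<le> ennreal ((4*pi) powr m) *
          (indicator (UNIV \<times> {0<..<1}) (- p) * ennreal (heat_kernel (fst (-p)) (snd (-p)) powr (n/n)))" for p
      proof (cases "- snd p \<in> {0<..<1}")
        case True
        have "\<psi> p \<le> 1 * G p * 1"
          unfolding \<psi>_def using \<kappa>nn \<eta>0 \<eta>le Gnn by (intro mult_mono) auto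
        also have "G p = (4*pi) powr m * (heat_kernel (fst (-p)) (snd (-p)) powr (n/n))"
        proof -
          have h: "heat_kernel (fst (-p)) (snd (-p)) = (4 * pi * (- snd p)) powr (- m) * exp (- (norm (fst p))\<^sup>2 / (4 * (- snd p)))"
            using True by (simp add: heat_kernel_def m_def n_def)
          have "(4 * pi * (- snd p)) powr (- m) = (4 * pi) powr (- m) * (- snd p) powr (- m)"
            using True powr_mult[of "4 * pi" "- snd p" "- m"] by simp
          moreover have "(4 * pi) powr m * (4 * pi) powr (- m) = 1"
            by (simp add: powr_minus)
          ultimately show ?thesis using n h by (simp add: G_def)
        qed
        finally show ?thesis using True by (cases p) (simp add: ennreal_mult[symmetric] ennreal_leI)
      next
        case False
        then have "\<psi> p = 0" using \<kappa>0[of "- snd p"] \<delta> by (auto simp: \<psi>_def)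
        then show ?thesis by simp
      qed
      have "(\<integral>\<^sup>+p. ennreal (\<psi> p) \<partial>lborel) \<le> (\<integral>\<^sup>+p. ennreal ((4*pi) powr m) *
          (indicator (UNIV \<times> {0<..<1}) (- p) * ennreal (heat_kernel (fst (-p)) (snd (-p)) powr (n/n))) \<partial>(lborel::('a\<times>real) measure))"
        by (rule nn_integral_mono) (use le in auto)
      also have "\<dots> = ennreal ((4*pi) powr m) * (\<integral>\<^sup>+p. 
          (indicator (UNIV \<times> {0<..<1}) (- p) * ennreal (heat_kernel (fst (-p)) (snd (-p)) powr (n/n))) \<partial>(lborel::('a\<times>real) measure))"
        by (rule nn_integral_cmult) (rule m2)
      also have "(\<integral>\<^sup>+p. 
          (indicator (UNIV \<times> {0<..<1}) (- p) * ennreal (heat_kernel (fst (-p)) (snd (-p)) powr (n/n))) \<partial>(lborel::('a\<times>real) measure))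
          = (\<integral>\<^sup>+p. indicator (UNIV \<times> {0<..<1}) p * ennreal (heat_kernel (fst p) (snd p) powr (n/n)) \<partial>(lborel::('a\<times>real) measure))"
        using nn_integral_lborel_affine[OF m1, of "-1" 0] by simp
      also have "\<dots> \<le> ennreal (Ck * 1 powr (n + 2 - n))"
        using Ck(2)[of 1] by simp
      also have "ennreal ((4*pi) powr m) * ennreal (Ck * 1 powr (n + 2 - n)) = ennreal ((4*pi) powr m * Ck)"
        using Ck(1) by (simp add: ennreal_mult[symmetric])
      also have "\<dots> \<le> ennreal C" using C1 by (rule ennreal_leI)
      finally have "(\<integral>\<^sup>+p. ennreal (\<psi> p) \<partial>lborel) \<le> ennreal C" by (simp add: mult_left_mono)
      then show ?thesis using C0 by (intro integral_real_bounded) auto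
    qed
    have lower: "exp (-1/4) * \<delta> powr (- real DIM('a) / 2 - 1) * indicator (cball 0 (sqrt (\<delta>/2)) \<times> {-8*\<delta>/10..-7*\<delta>/10}) p
             - C * indicator (cball 0 1 \<times> {-1..0}) p
           \<le> - \<psi>t p - (\<Sum>i\<in>Basis. \<psi>xx i p)" for p
    proof -
      define N where "N = cball (0::'a) (sqrt (\<delta>/2)) \<times> {-8*\<delta>/10..-7*\<delta>/10}"
      have "norm a \<le> 1" if "norm a \<le> sqrt (\<delta>/2)" for a :: 'a
        using order_trans[OF that, of 1] \<delta> by simp
      then have NK: "N \<subseteq> K" using \<delta> by (auto simp: N_def K_def)
      have KQ: "K \<subseteq> cball 0 1 \<times> {-1..0}" using \<delta> by (auto simp: K_def)
      show ?thesis
      proof (cases "p \<in> K")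
        case False
        then have "p \<notin> N" using NK by auto
        then show ?thesis using False sup0[OF False] C0 by (simp add: N_def indicator_def)
      next
        case True
        obtain y s where p: "p = (y, s)" by (cases p)
        define \<tau> where "\<tau> = - s"
        have \<tau>: "\<delta>/2 \<le> \<tau>" "\<tau> \<le> 1" "\<tau> > 0" and y: "norm y \<le> 1"
          using True \<delta> by (auto simp: p K_def \<tau>_def)
        have q1: "q p \<le> 1" "q p \<ge> 0" using y by (auto simp: q_def p power_le_one)
        have kp: "k p = 1 / (4 * \<tau>)" by (simp add: k_def p \<tau>_def)
        have sumsq: "(\<Sum>i\<in>Basis. (y \<bullet> i)\<^sup>2) = q p"
          unfolding q_def p fst_conv power2_norm_eq_inner by (subst (2) euclidean_inner) (simp add: power2_eq_square)
        have "(\<Sum>i\<in>Basis. \<psi>xx i p) = \<kappa> \<tau> * G p * (2 * n * (\<eta>1 (q p) - k p * \<eta> (q p))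
           + 4 * q p * (\<eta>2 (q p) - 2 * k p * \<eta>1 (q p) + (k p)\<^sup>2 * \<eta> (q p)))"
          by (simp add: \<psi>xx_def p \<tau>_def[symmetric] sum_distrib_left[symmetric] sum.distrib
              sum_distrib_right[symmetric] sumsq[unfolded p] n_def)
        \<comment> \<open>All terms without a derivative of a cutoff cancel, because
          \<open>G\<close> solves the backward heat equation.\<close>
        then have L: "- \<psi>t p - (\<Sum>i\<in>Basis. \<psi>xx i p)
            = G p * \<kappa>1 \<tau> * \<eta> (q p) - \<kappa> \<tau> * G p * (2 * n * \<eta>1 (q p) + 4 * q p * \<eta>2 (q p) - 8 * q p * k p * \<eta>1 (q p))"
          by (simp add: \<psi>t_def p \<tau>_def[symmetric] algebra_simps)
        have Gp: "G p = \<tau> powr (- m) * exp (- q p / (4 * \<tau>))" by (simp add: G_def p \<tau>_def q_def)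
        \<comment> \<open>The three summands contribute \<open>2*n\<close>, 4 and
          \<open>2 / \<tau>\<close> times \<open>B\<close>. As \<open>\<tau> \<le> 1\<close>, they
          add up to at most \<open>(2*n+6) * B / \<tau>\<close>, and \<open>S\<close> absorbs the
          factor \<open>1 / \<tau>\<close>.\<close>
        have b2: "\<kappa> \<tau> * G p * (2 * n * \<eta>1 (q p) + 4 * q p * \<eta>2 (q p) - 8 * q p * k p * \<eta>1 (q p)) \<le> (2*n + 6) * B * S"
        proof (cases "q p \<le> 1/2")
          case True
          then show ?thesis using \<eta>10 \<eta>20 B S0 n by simp
        next
          case False
          have t1: "2 * n * \<eta>1 (q p) \<le> 2 * n * B" using B1[of "q p"] n by (intro mult_left_mono) auto
          have t2: "4 * q p * \<eta>2 (q p) \<le> 4 * 1 * B"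
            using B2[of "q p"] q1 B by (intro order_trans[OF mult_left_mono[of "\<eta>2 (q p)" B] mult_right_mono]) auto
          have t3: "- (8 * q p * k p * \<eta>1 (q p)) \<le> 2 / \<tau> * B"
          proof -
            have "8 * q p * k p * (- \<eta>1 (q p)) \<le> 8 * 1 * k p * B"
              using B1[of "q p"] q1 B \<tau> kp \<eta>1le[of "q p"] by (intro mult_mono) auto
            then show ?thesis by (simp add: kp)
          qed
          have t4: "(2*n+4) * B \<le> (2*n+4) * B / \<tau>" 
            using \<tau> mult_left_le[of \<tau> "(2*n+4) * B"] B n by (simp add: le_divide_eq)
          have T: "2 * n * \<eta>1 (q p) + 4 * q p * \<eta>2 (q p) - 8 * q p * k p * \<eta>1 (q p) \<le> (2*n+6) * B / \<tau>"
          proof -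
            have "(2*n+6) * B / \<tau> = (2*n+4) * B / \<tau> + 2 / \<tau> * B" using \<tau> by (simp add: field_simps)
            moreover have "(2*n+4) * B = 2 * n * B + 4 * 1 * B" by (simp add: algebra_simps)
            ultimately show ?thesis using t1 t2 t3 t4 by linarith
          qed
          have GS: "G p / \<tau> \<le> S"
          proof -
            have "G p \<le> \<tau> powr (- m) * exp (- (1/2) / (4 * \<tau>))"
              unfolding Gp using False \<tau> by (intro mult_left_mono) (auto simp: field_simps)
            then have "G p / \<tau> \<le> \<tau> powr (- m) * exp (- (1/2) / (4 * \<tau>)) / \<tau>"
              using \<tau> by (intro divide_right_mono) auto
            then show ?thesis using S[OF \<tau>(3)] by linarith
          qed
          have "\<kappa> \<tau> * G p * (2 * n * \<eta>1 (q p) + 4 * q p * \<eta>2 (q p) - 8 * q p * k p * \<eta>1 (q p))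
              \<le> \<kappa> \<tau> * G p * ((2*n+6) * B / \<tau>)"
            using T \<kappa>nn Gnn by (intro mult_left_mono) auto
          also have "\<dots> \<le> 1 * G p * ((2*n+6) * B / \<tau>)"
            using \<kappa>nn Gnn B n \<tau> by (intro mult_right_mono) auto
          also have "\<dots> = (2*n+6) * B * (G p / \<tau>)" by simp
          also have "\<dots> \<le> (2*n+6) * B * S" using GS B n by (intro mult_left_mono) auto
          finally show ?thesis .
        qed
        have b1: "G p * ((1 - \<eta> (\<tau>/\<delta>)) * \<eta>1 \<tau>) * \<eta> (q p) \<ge> - (B * 2 powr m)"
        proof (cases "\<tau> \<le> 1/2")
          case True
          then show ?thesis using \<eta>10 B by simp
        next
          case False
          have "\<tau> powr (- m) \<le> (1/2) powr (- m)" using False m by (intro powr_mono2') auto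
          then have "\<tau> powr (- m) \<le> 2 powr m" by (simp add: powr_minus powr_divide)
          then have G2: "G p \<le> 2 powr m * 1"
            unfolding Gp using \<tau> q1 by (intro mult_mono) auto
          have "G p * ((1 - \<eta> (\<tau>/\<delta>)) * (- \<eta>1 \<tau>)) * \<eta> (q p) \<le> (2 powr m * 1) * (1 * B) * 1"
            using G2 \<eta>0 \<eta>le Gnn \<eta>1le[of \<tau>] B1[of \<tau>] B
            by (intro mult_mono mult_nonneg_nonneg) (auto intro!: mult_nonneg_nonpos)
          then show ?thesis by (simp add: mult.commute)
        qed
        \<comment> \<open>On \<open>N\<close> the cutoffs \<open>\<eta> \<tau>\<close> and
          \<open>\<eta> (q p)\<close> equal 1, and \<open>q p / (4 * \<tau>)\<close> is at most
          5/28, below 1/4. The power of \<open>\<delta>\<close> is \<open>- m\<close> from the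
          kernel and -1 from differentiating \<open>\<eta> (\<tau>/\<delta>)\<close>.\<close>
        have b0: "exp (-1/4) * \<delta> powr (- n / 2 - 1) * indicator N p \<le> G p * (- (\<eta>1 (\<tau>/\<delta>) / \<delta>) * \<eta> \<tau>) * \<eta> (q p)"
        proof (cases "p \<in> N")
          case False
          have "0 \<le> - (\<eta>1 (\<tau>/\<delta>) / \<delta>)" using \<eta>1le[of "\<tau>/\<delta>"] \<delta> by (simp add: field_simps)
          then have "0 \<le> G p * (- (\<eta>1 (\<tau>/\<delta>) / \<delta>) * \<eta> \<tau>) * \<eta> (q p)"
            using Gnn \<eta>0 by (intro mult_nonneg_nonneg)
          then show ?thesis using False by simp
        next
          case True
          have t: "7*\<delta>/10 \<le> \<tau>" "\<tau> \<le> 8*\<delta>/10" and ny: "norm y \<le> sqrt (\<delta>/2)"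
            using True by (auto simp: N_def p \<tau>_def)
          have "(norm y)\<^sup>2 \<le> (sqrt (\<delta>/2))\<^sup>2" by (intro power_mono ny) auto
          then have q2: "q p \<le> \<delta>/2" using \<delta> by (simp add: q_def p)
          have e1: "\<eta> (q p) = 1" "\<eta> \<tau> = 1" using \<eta>one[of "q p"] \<eta>one[of \<tau>] q2 t \<delta> by auto
          have e2: "1 \<le> - \<eta>1 (\<tau>/\<delta>)" using low[of "\<tau>/\<delta>"] t \<delta> by (simp add: field_simps)
          then have e3: "1/\<delta> \<le> - (\<eta>1 (\<tau>/\<delta>) / \<delta>)" using \<delta> by (simp add: field_simps)
          have "\<delta> powr (- m) \<le> \<tau> powr (- m)" using t \<tau> m \<delta> by (intro powr_mono2') auto
          moreover have "exp (-1/4) \<le> exp (- q p / (4 * \<tau>))"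
            using q2 t \<tau> \<delta> by (simp add: field_simps)
          ultimately have G1: "\<delta> powr (- m) * exp (-1/4) \<le> G p"
            unfolding Gp by (intro mult_mono) auto
          have "\<delta> powr (- m) * exp (-1/4) * (1/\<delta>) \<le> G p * (- (\<eta>1 (\<tau>/\<delta>) / \<delta>))"
            using G1 e3 \<delta> Gnn by (intro mult_mono) auto
          moreover have "\<delta> powr (- n / 2 - 1) = \<delta> powr (- m) * (1/\<delta>)"
            using \<delta> by (simp add: powr_diff m_def)
          ultimately show ?thesis using True e1 by (simp add: mult_ac)
        qed
        have "G p * \<kappa>1 \<tau> * \<eta> (q p) = G p * (- (\<eta>1 (\<tau>/\<delta>) / \<delta>) * \<eta> \<tau>) * \<eta> (q p) + G p * ((1 - \<eta> (\<tau>/\<delta>)) * \<eta>1 \<tau>) * \<eta> (q p)"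
          by (simp add: \<kappa>1_def algebra_simps)
        moreover have "indicator (cball 0 1 \<times> {-1..0}) p = (1::real)" using True KQ by auto
        ultimately show ?thesis
          unfolding L N_def[symmetric] n_def[symmetric] using b0 b1 b2 C2 by simp
      qed
    qed
    show ?thesis
      using pd sup0[unfolded K_def] nn int lower by blast
  qed
  show thesis
    by (rule that[of C "exp (-1/4)"]) (use C0 main in auto)
qed

lemma measure_lborel_Times:
  fixes A :: "'a::euclidean_space set" and B :: "'b::euclidean_space set"
  assumes "A \<in> sets borel" "B \<in> sets borel"
  shows "measure lborel (A \<times> B) = measure lborel A * measure lborel B"
  using assms
  by (simp add: measure_def lborel_prod[symmetric] lborel.emeasure_pair_measure_Times enn2real_mult)

text \<open>Pairing the differential inequality with the truncated backward kernel gives at most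
  \<open>C * A\<close>. By Green's identity the same pairing is at least a fixed multiple
  \<open>b\<close> of the values of \<open>w\<close> close to the origin, minus a multiple of its
  integral over the cylinder. Shrinking the scale \<open>\<delta>\<close> turns those values into
  \<open>w (0, 0)\<close> by continuity, with constants independent of
  \<open>\<delta>\<close>.\<close>

lemma heat_subsolution_mean_value:
  obtains C where "C > 0"
    "\<And>(w :: 'a::euclidean_space \<times> real \<Rightarrow> real) wx wxx wt I A.
      open I \<Longrightarrow> {-1..0} \<subseteq> I \<Longrightarrow> parabolic_derivs I w wx wxx wt \<Longrightarrow> (\<And>p. 0 \<le> w p) \<Longrightarrow> 0 \<le> A \<Longrightarrow>
      (\<And>p. p \<in> cball 0 1 \<times> {-1..0} \<Longrightarrow> wt p - (\<Sum>i\<in>Basis. wxx i p) \<le> A) \<Longrightarrow>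
      w (0, 0) \<le> C * (A + (\<integral>p. indicator (cball 0 1 \<times> {-1..0}) p * w p \<partial>lborel))"
proof -
  obtain C c :: real where C: "C > 0" and c: "c > 0" and test:
    "\<And>\<delta>. 0 < \<delta> \<Longrightarrow> \<delta> \<le> 1/2 \<Longrightarrow>
      \<exists>(\<psi> :: 'a \<times> real \<Rightarrow> real) \<psi>x \<psi>xx \<psi>t. parabolic_derivs UNIV \<psi> \<psi>x \<psi>xx \<psi>t \<and>
        (\<forall>p. p \<notin> cball 0 1 \<times> {-1..-\<delta>/2} \<longrightarrow>
           \<psi> p = 0 \<and> \<psi>t p = 0 \<and> (\<forall>i\<in>Basis. \<psi>x i p = 0 \<and> \<psi>xx i p = 0)) \<and>
        (\<forall>p. 0 \<le> \<psi> p) \<and> (\<integral>p. \<psi> p \<partial>lborel) \<le> C \<and>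
        (\<forall>p. c * \<delta> powr (- real DIM('a) / 2 - 1) * indicator (cball 0 (sqrt (\<delta>/2)) \<times> {-8*\<delta>/10..-7*\<delta>/10}) p
             - C * indicator (cball 0 1 \<times> {-1..0}) p
           \<le> - \<psi>t p - (\<Sum>i\<in>Basis. \<psi>xx i p))"
    by (rule heat_test_function[where 'a='a]) blast
  define m where "m = real DIM('a) / 2"
  define V where "V = unit_ball_vol (real DIM('a))"
  have V: "V > 0" by (simp add: V_def unit_ball_vol_pos)
  \<comment> \<open>This is \<open>c * \<delta> powr (- m - 1)\<close> times the volume
    \<open>V * (\<delta>/2) powr m * (\<delta>/10)\<close> of the set \<open>N\<close> below; all
    powers of \<open>\<delta>\<close> cancel.\<close>
  define b where "b = c * 2 powr (- m) * V / 10"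
  have b: "b > 0" using c V by (simp add: b_def)
  define Q where "Q = cball (0::'a) 1 \<times> {-1..0::real}"
  have Qc: "compact Q" by (simp add: Q_def compact_Times)
  show thesis
  proof (rule that[of "C / b"])
    show "C / b > 0" using C b by simp
    fix w :: "'a \<times> real \<Rightarrow> real" and wx wxx wt I A
    assume I: "open I" "{-1..0} \<subseteq> I" and pw: "parabolic_derivs I w wx wxx wt" and w0: "\<And>p. 0 \<le> w p"
      and A: "0 \<le> A" and sub: "\<And>p. p \<in> cball 0 1 \<times> {-1..0} \<Longrightarrow> wt p - (\<Sum>i\<in>Basis. wxx i p) \<le> A"
    have cw: "continuous_on (UNIV \<times> I) w" using pw by (simp add: parabolic_derivs_def)
    have QI: "Q \<subseteq> UNIV \<times> I" using I by (auto simp: Q_def)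
    have iQ: "integrable lborel (\<lambda>p. indicator Q p * w p)"
      using borel_integrable_compact[OF Qc continuous_on_subset[OF cw QI]] by simp
    define J where "J = (\<integral>p. indicator Q p * w p \<partial>lborel)"
    have key: "b * (w (0, 0) - \<epsilon>) \<le> C * A + C * J" if \<epsilon>: "\<epsilon> > 0" for \<epsilon>
    proof -
      have "0 \<in> I" using I(2) by (rule subsetD) simp
      then have "isCont w (0, 0)"
        using cw I(1) by (subst (asm) continuous_on_eq_continuous_at) (auto simp: open_Times)
      then obtain r where r: "r > 0" "\<And>p. dist p (0, 0) < r \<Longrightarrow> dist (w p) (w (0, 0)) < \<epsilon>"
        using \<epsilon> unfolding continuous_at_eps_delta by blast
      \<comment> \<open>Small enough for \<open>N\<close> to lie within distance \<open>r\<close> of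
        the origin: both \<open>sqrt (\<delta>/2)\<close> and \<open>\<delta>\<close> are at most
        \<open>sqrt \<delta>\<close>, which is at most \<open>r / 4\<close>.\<close>
      define \<delta> where "\<delta> = min (1/2) (r\<^sup>2 / 16)"
      have \<delta>: "0 < \<delta>" "\<delta> \<le> 1/2" using r(1) by (auto simp: \<delta>_def)
      define N where "N = cball (0::'a) (sqrt (\<delta>/2)) \<times> {-8*\<delta>/10..-7*\<delta>/10}"
      have sd: "sqrt \<delta> \<le> r / 4"
        using r(1) by (intro real_le_lsqrt) (auto simp: \<delta>_def power_divide min_def)
      have d2: "\<delta> \<le> sqrt \<delta>" using \<delta> by (intro real_le_rsqrt) (auto simp: power2_eq_square mult_left_le)
      have wN: "w p \<ge> w (0, 0) - \<epsilon>" if "p \<in> N" for p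
      proof -
        obtain y s where p: "p = (y, s)" by (cases p)
        have "norm y \<le> sqrt (\<delta>/2)" "\<bar>s\<bar> \<le> \<delta>" using that \<delta> by (auto simp: p N_def)
        moreover have "sqrt (\<delta>/2) \<le> sqrt \<delta>" using \<delta> by simp
        moreover have "norm p \<le> norm y + \<bar>s\<bar>" using norm_Pair_le[of y s] by (simp add: p)
        ultimately have "norm p < r" using sd d2 r(1) by linarith
        then have "dist (w p) (w (0, 0)) < \<epsilon>" using r(2)[of p] by (simp add: zero_prod_def[symmetric])
        then show ?thesis by (simp add: dist_real_def)
      qed
      obtain \<psi> \<psi>x \<psi>xx \<psi>t where pd: "parabolic_derivs UNIV \<psi> \<psi>x \<psi>xx \<psi>t"
        and sup: "\<And>p. p \<notin> cball 0 1 \<times> {-1..-\<delta>/2} \<Longrightarrow>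
           \<psi> p = 0 \<and> \<psi>t p = 0 \<and> (\<forall>i\<in>Basis. \<psi>x i p = 0 \<and> \<psi>xx i p = 0)"
        and p0: "\<And>p. 0 \<le> \<psi> p" and ip: "(\<integral>p. \<psi> p \<partial>lborel) \<le> C"
        and low: "\<And>p. c * \<delta> powr (- m - 1) * indicator N p - C * indicator Q p \<le> - \<psi>t p - (\<Sum>i\<in>Basis. \<psi>xx i p)"
        using test[OF \<delta>] unfolding m_def N_def Q_def by auto
      define K where "K = cball (0::'a) 1 \<times> {-1..-\<delta>/2}"
      have Kc: "compact K" by (simp add: K_def compact_Times)
      have KQ: "K \<subseteq> Q" using \<delta> by (auto simp: K_def Q_def)
      have cp: "continuous_on UNIV \<psi>" using pd by (simp add: parabolic_derivs_def)
      have ipsi: "integrable lborel \<psi>"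
        by (rule integrable_continuous_compact_support[OF cp Kc]) (use sup K_def in auto)
      have KI: "K \<subseteq> UNIV \<times> I" using KQ QI by auto
      note green = green_identity_heat[OF I(1) pw pd Kc KI]
      have g1: "integrable lborel (\<lambda>p. \<psi> p * (wt p - (\<Sum>i\<in>Basis. wxx i p)))"
        and g2: "integrable lborel (\<lambda>p. w p * (- \<psi>t p - (\<Sum>i\<in>Basis. \<psi>xx i p)))"
        and g3: "(\<integral>p. \<psi> p * (wt p - (\<Sum>i\<in>Basis. wxx i p)) \<partial>lborel)
          = (\<integral>p. w p * (- \<psi>t p - (\<Sum>i\<in>Basis. \<psi>xx i p)) \<partial>lborel)"
        using green sup unfolding K_def by blast+
      have "(\<integral>p. \<psi> p * (wt p - (\<Sum>i\<in>Basis. wxx i p)) \<partial>lborel) \<le> (\<integral>p. \<psi> p * A \<partial>lborel)"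
      proof (rule integral_mono[OF g1])
        show "integrable lborel (\<lambda>p. \<psi> p * A)" using ipsi by simp
        show "\<psi> p * (wt p - (\<Sum>i\<in>Basis. wxx i p)) \<le> \<psi> p * A" for p
        proof (cases "p \<in> K")
          case True
          then show ?thesis using sub[of p] KQ p0[of p] by (intro mult_left_mono) (auto simp: Q_def)
        qed (use sup K_def in auto)
      qed
      also have "\<dots> \<le> C * A" using ip A by (simp add: mult_right_mono)
      finally have up: "(\<integral>p. w p * (- \<psi>t p - (\<Sum>i\<in>Basis. \<psi>xx i p)) \<partial>lborel) \<le> C * A"
        using g3 by simp
      define a where "a = c * \<delta> powr (- m - 1)"
      have a: "a > 0" using c \<delta> by (simp add: a_def)
      have iN: "integrable lborel (\<lambda>p. indicator N p * (a * (w (0, 0) - \<epsilon>)))"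
        using borel_integrable_compact[of N "\<lambda>_. a * (w (0, 0) - \<epsilon>)"] by (simp add: N_def compact_Times)
      have "(\<integral>p. indicator N p * (a * (w (0, 0) - \<epsilon>)) - C * (indicator Q p * w p) \<partial>lborel)
          \<le> (\<integral>p. w p * (- \<psi>t p - (\<Sum>i\<in>Basis. \<psi>xx i p)) \<partial>lborel)"
      proof (rule integral_mono[OF _ g2])
        show "integrable lborel (\<lambda>p. indicator N p * (a * (w (0, 0) - \<epsilon>)) - C * (indicator Q p * w p))"
          using iN iQ by auto
        show "indicator N p * (a * (w (0, 0) - \<epsilon>)) - C * (indicator Q p * w p)
            \<le> w p * (- \<psi>t p - (\<Sum>i\<in>Basis. \<psi>xx i p))" for p
        proof -
          have "w p * (a * indicator N p - C * indicator Q p) \<le> w p * (- \<psi>t p - (\<Sum>i\<in>Basis. \<psi>xx i p))"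
            using low[of p] w0[of p] by (intro mult_left_mono) (auto simp: a_def)
          moreover have "indicator N p * (a * (w (0, 0) - \<epsilon>)) \<le> w p * (a * indicator N p)"
            using wN[of p] a by (cases "p \<in> N") (auto simp: mult.commute)
          ultimately show ?thesis by (simp add: algebra_simps)
        qed
      qed
      moreover have "(\<integral>p. indicator N p * (a * (w (0, 0) - \<epsilon>)) - C * (indicator Q p * w p) \<partial>lborel)
          = measure lborel N * a * (w (0, 0) - \<epsilon>) - C * J"
        using iN iQ by (simp add: J_def)
      moreover have "measure lborel N * a = b"
      proof -
        have "measure lborel N = measure lborel (cball (0::'a) (sqrt (\<delta>/2))) * measure lborel {-8*\<delta>/10..-7*\<delta>/10}"
          unfolding N_def by (rule measure_lborel_Times) auto
        also have "measure lborel (cball (0::'a) (sqrt (\<delta>/2))) = V * sqrt (\<delta>/2) ^ DIM('a)"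
          using \<delta> by (simp add: V_def content_cball)
        also have "sqrt (\<delta>/2) ^ DIM('a) = (\<delta>/2) powr m"
          using \<delta> by (simp add: m_def powr_half_sqrt[symmetric] powr_realpow[symmetric] powr_powr)
        also have "(\<delta>/2) powr m = \<delta> powr m * 2 powr (- m)"
          using \<delta> by (simp add: powr_divide powr_minus_divide)
        also have "measure lborel {-8*\<delta>/10..-7*\<delta>/10} = \<delta> / 10" using \<delta> by simp
        finally have "measure lborel N * a = b * (\<delta> powr m * \<delta> powr (- m - 1) * \<delta>)"
          by (simp add: a_def b_def mult_ac)
        also have "\<delta> powr m * \<delta> powr (- m - 1) * \<delta> = 1"
          using \<delta> by (simp add: powr_add[symmetric] powr_minus)
        finally show ?thesis by simp
      qed
      ultimately show ?thesis using up by simp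
    qed
    have "b * w (0, 0) \<le> C * A + C * J"
    proof (rule field_le_epsilon)
      fix e :: real assume "e > 0"
      then show "b * w (0, 0) \<le> C * A + C * J + e"
        using key[of "e / b"] b by (simp add: right_diff_distrib)
    qed
    then show "w (0, 0) \<le> C / b * (A + (\<integral>p. indicator (cball 0 1 \<times> {-1..0}) p * w p \<partial>lborel))"
      using b by (simp add: J_def Q_def field_simps)
  qed
qed

section \<open>The potential and the rescaled equation\<close>

text \<open>For \<open>\<tau> \<ge> \<rho>\<^sup>2\<close> the prefactor
  \<open>\<tau> powr (- a/2)\<close> suffices. For smaller \<open>\<tau>\<close> it blows up, but
  then \<open>norm y > \<rho>\<close> and the Gaussian wins: with
  \<open>z = \<rho>\<^sup>2 / \<tau>\<close> there remains
  \<open>z powr (a/2) * exp (- a * z / (4*n))\<close>, at most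
  \<open>(2*n) powr (a/2)\<close>.\<close>

lemma heat_kernel_powr_far_bound:
  fixes y :: "'a::euclidean_space"
  assumes a: "0 < a" and \<rho>: "\<rho> > 0" and \<tau>: "\<tau> > 0" and far: "\<rho> < norm y \<or> \<rho>\<^sup>2 \<le> \<tau>"
  shows "heat_kernel y \<tau> powr (a / real DIM('a)) \<le> (1 + (2 * real DIM('a)) powr (a/2)) * \<rho> powr (- a)"
proof -
  define n where "n = real DIM('a)"
  have n: "n > 0" by (simp add: n_def)
  define E where "E = exp (- (a / (4 * n)) * (norm y)\<^sup>2 / \<tau>)"
  have sq: "(\<rho>\<^sup>2) powr (- a / 2) = \<rho> powr (- a)"
  proof -
    have "\<rho>\<^sup>2 = \<rho> powr 2" using \<rho> by simp
    then show ?thesis by (simp only: powr_powr) simp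
  qed
  have "1 \<le> 4 * pi" using pi_gt3 by simp
  then have "(4 * pi * \<tau>) powr (- a / 2) \<le> \<tau> powr (- a / 2)"
    using \<tau> a by (intro powr_mono2') auto
  then have le: "heat_kernel y \<tau> powr (a / n) \<le> \<tau> powr (- a / 2) * E"
    using heat_kernel_powr[OF \<tau>, of y a] by (simp add: n_def E_def mult_right_mono)
  have E1: "E \<le> 1" using a n \<tau> by (simp add: E_def)
  have "\<tau> powr (- a / 2) * E \<le> (1 + (2 * n) powr (a/2)) * \<rho> powr (- a)"
  proof (cases "\<rho>\<^sup>2 \<le> \<tau>")
    case True
    have "\<tau> powr (- a / 2) \<le> (\<rho>\<^sup>2) powr (- a / 2)" using True \<rho> a by (intro powr_mono2') auto
    then have "\<tau> powr (- a / 2) * E \<le> \<rho> powr (- a) * 1"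
      unfolding sq using E1 by (intro mult_mono) (auto simp: E_def)
    also have "\<dots> \<le> (1 + (2 * n) powr (a/2)) * \<rho> powr (- a)" by (simp add: algebra_simps)
    finally show ?thesis .
  next
    case False
    then have y: "\<rho> < norm y" using far by simp
    define z where "z = \<rho>\<^sup>2 / \<tau>"
    have z: "z > 0" using \<rho> \<tau> by (simp add: z_def)
    have "\<rho>\<^sup>2 \<le> (norm y)\<^sup>2" using y \<rho> by (intro power_mono) auto
    then have "(a / (4 * n)) * \<rho>\<^sup>2 / \<tau> \<le> (a / (4 * n)) * (norm y)\<^sup>2 / \<tau>"
      using a n \<tau> by (intro divide_right_mono mult_left_mono) auto
    then have "E \<le> exp (- (a / (4 * n)) * z)" by (simp add: E_def z_def)
    moreover have "\<tau> powr (- a / 2) = \<rho> powr (- a) * z powr (a / 2)"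
    proof -
      have "\<tau> = \<rho>\<^sup>2 / z" using \<rho> \<tau> by (simp add: z_def)
      then have "\<tau> powr (- a / 2) = (\<rho>\<^sup>2) powr (- a / 2) / z powr (- a / 2)"
        using \<rho> z by (simp add: powr_divide)
      also have "\<dots> = (\<rho>\<^sup>2) powr (- a / 2) * z powr (a / 2)" by (simp add: powr_minus_divide)
      finally show ?thesis by (simp only: sq)
    qed
    ultimately have "\<tau> powr (- a / 2) * E \<le> \<rho> powr (- a) * (z powr (a / 2) * exp (- (a / (4 * n)) * z))"
      by (simp add: mult.assoc mult_left_mono)
    also have "\<dots> \<le> \<rho> powr (- a) * ((a / 2) / (a / (4 * n))) powr (a / 2)"
      using powr_times_exp_bound[of "a / 2" "a / (4 * n)" z] a n z by (intro mult_left_mono) auto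
    also have "(a / 2) / (a / (4 * n)) = 2 * n" using a n by (simp add: field_simps)
    also have "\<rho> powr (- a) * (2 * n) powr (a / 2) \<le> (1 + (2 * n) powr (a/2)) * \<rho> powr (- a)"
      by (subst mult.commute) (rule mult_right_mono, auto)
    finally show ?thesis .
  qed
  then show ?thesis using le by (simp add: n_def)
qed

text \<open>Near the pole \<open>F\<close> is replaced by \<open>L\<close> and the singular kernel
  is integrated over the strip of elapsed times below \<open>\<rho>\<^sup>2\<close>. Elsewhere the
  kernel is at most a multiple of \<open>\<rho> powr (- a)\<close>, which leaves the mass of
  \<open>F\<close> before time \<open>t\<close>. With values in \<open>ennreal\<close> no
  integrability of \<open>F\<close> has to be assumed.\<close>

lemma heat_potential_bound:
  assumes a: "0 < a" "a < real DIM('a) + 2"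
  obtains C where "C \<ge> 0"
    "\<And>(F :: 'a::euclidean_space \<times> real \<Rightarrow> ennreal) x t \<rho> L.
      F \<in> borel_measurable borel \<Longrightarrow> \<rho> > 0 \<Longrightarrow>
      (\<And>y s. norm (x - y) \<le> \<rho> \<Longrightarrow> t - \<rho>\<^sup>2 < s \<Longrightarrow> s < t \<Longrightarrow> F (y, s) \<le> L) \<Longrightarrow>
      (\<integral>\<^sup>+p. ennreal (heat_kernel (x - fst p) (t - snd p) powr (a / real DIM('a))) * F p \<partial>lborel)
      \<le> ennreal (C * \<rho> powr (real DIM('a) + 2 - a)) * L
        + ennreal (C * \<rho> powr (- a)) * (\<integral>\<^sup>+p. indicator (UNIV \<times> {..<t}) p * F p \<partial>lborel)"
proof -
  define n where "n = real DIM('a)"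
  obtain Ck where Ck: "Ck \<ge> 0" "\<And>R. R > 0 \<Longrightarrow>
    (\<integral>\<^sup>+(p::'a \<times> real). indicator (UNIV \<times> {0<..<R\<^sup>2}) p *
       ennreal (heat_kernel (fst p) (snd p) powr (a / n)) \<partial>lborel)
    \<le> ennreal (Ck * R powr (n + 2 - a))"
    unfolding n_def by (rule heat_kernel_powr_nn_integral[OF a]) blast
  define Cf where "Cf = 1 + (2 * n) powr (a/2)"
  define C where "C = Ck + Cf"
  have Cf: "Cf \<ge> 0" by (simp add: Cf_def)
  show thesis
  proof (rule that[of C])
    show "C \<ge> 0" using Cf Ck(1) by (simp add: C_def)
    fix F :: "'a \<times> real \<Rightarrow> ennreal" and x t \<rho> L
    assume F: "F \<in> borel_measurable borel" and \<rho>: "\<rho> > 0"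
      and near: "\<And>y s. norm (x - y) \<le> \<rho> \<Longrightarrow> t - \<rho>\<^sup>2 < s \<Longrightarrow> s < t \<Longrightarrow> F (y, s) \<le> L"
    define k where "k = (\<lambda>p::'a \<times> real. indicator (UNIV \<times> {0<..<\<rho>\<^sup>2}) p * ennreal (heat_kernel (fst p) (snd p) powr (a / n)))"
    have km: "k \<in> borel_measurable borel"
      unfolding k_def by (rule indicator_heat_kernel_powr_measurable) (auto intro!: borel_open open_Times)
    define k' where "k' = (\<lambda>p. k ((x, t) - p))"
    have km': "k' \<in> borel_measurable borel"
      unfolding k'_def by (rule measurable_compose[OF _ km]) auto
    have Gm: "(\<lambda>p. indicator (UNIV \<times> {..<t}) p * F p) \<in> borel_measurable borel"
      by (intro borel_measurable_times_ennreal borel_measurable_indicator F) (auto intro!: borel_open open_Times)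
    have pt: "ennreal (heat_kernel (x - fst p) (t - snd p) powr (a / n)) * F p
        \<le> k' p * L + ennreal (Cf * \<rho> powr (- a)) * (indicator (UNIV \<times> {..<t}) p * F p)" for p
    proof -
      obtain y s where p: "p = (y, s)" by (cases p)
      show ?thesis
      proof (cases "s < t")
        case False
        then show ?thesis by (simp add: p heat_kernel_def)
      next
        case True
        show ?thesis
        proof (cases "norm (x - y) \<le> \<rho> \<and> t - s < \<rho>\<^sup>2")
          case near': True
          have "ennreal (heat_kernel (x - fst p) (t - snd p) powr (a / n)) * F p \<le> k' p * L"
            using near[of y s] near' True by (auto simp: p k'_def k_def intro!: mult_left_mono)
          then show ?thesis by (rule add_increasing2[rotated]) simp
        next
          case far: False
          have "heat_kernel (x - y) (t - s) powr (a / n) \<le> Cf * \<rho> powr (- a)"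
            unfolding n_def Cf_def using far True by (intro heat_kernel_powr_far_bound a \<rho>) auto
          then have "ennreal (heat_kernel (x - fst p) (t - snd p) powr (a / n)) * F p
              \<le> ennreal (Cf * \<rho> powr (- a)) * (indicator (UNIV \<times> {..<t}) p * F p)"
            using True by (simp add: p mult_right_mono ennreal_leI)
          then show ?thesis by (rule add_increasing[rotated]) simp
        qed
      qed
    qed
    have "(\<integral>\<^sup>+p. ennreal (heat_kernel (x - fst p) (t - snd p) powr (a / n)) * F p \<partial>lborel)
       \<le> (\<integral>\<^sup>+p. k' p * L + ennreal (Cf * \<rho> powr (- a)) * (indicator (UNIV \<times> {..<t}) p * F p) \<partial>lborel)"
      by (rule nn_integral_mono) (rule pt)
    also have "\<dots> = (\<integral>\<^sup>+p. k' p * L \<partial>lborel) + (\<integral>\<^sup>+p. ennreal (Cf * \<rho> powr (- a)) * (indicator (UNIV \<times> {..<t}) p * F p) \<partial>lborel)"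
      by (rule nn_integral_add) (use km' Gm in \<open>auto intro!: borel_measurable_times_ennreal\<close>)
    also have "(\<integral>\<^sup>+p. k' p * L \<partial>lborel) = (\<integral>\<^sup>+p. k' p \<partial>lborel) * L"
      by (rule nn_integral_multc) (use km' in auto)
    also have "(\<integral>\<^sup>+p. k' p \<partial>lborel) = (\<integral>\<^sup>+p. k p \<partial>lborel)"
      using nn_integral_lborel_affine[OF km, of "-1" "(x, t)"] by (simp add: k'_def)
    also have "(\<integral>\<^sup>+p. ennreal (Cf * \<rho> powr (- a)) * (indicator (UNIV \<times> {..<t}) p * F p) \<partial>lborel)
        = ennreal (Cf * \<rho> powr (- a)) * (\<integral>\<^sup>+p. indicator (UNIV \<times> {..<t}) p * F p \<partial>lborel)"
      by (rule nn_integral_cmult) (use Gm in auto)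
    also have "(\<integral>\<^sup>+p. k p \<partial>lborel) * L + ennreal (Cf * \<rho> powr (- a)) * (\<integral>\<^sup>+p. indicator (UNIV \<times> {..<t}) p * F p \<partial>lborel)
      \<le> ennreal (C * \<rho> powr (n + 2 - a)) * L
        + ennreal (C * \<rho> powr (- a)) * (\<integral>\<^sup>+p. indicator (UNIV \<times> {..<t}) p * F p \<partial>lborel)"
    proof (intro add_mono mult_right_mono)
      have "(\<integral>\<^sup>+p. k p \<partial>lborel) \<le> ennreal (Ck * \<rho> powr (n + 2 - a))"
        unfolding k_def by (rule Ck(2)[OF \<rho>])
      also have "\<dots> \<le> ennreal (C * \<rho> powr (n + 2 - a))"
        using Cf by (intro ennreal_leI mult_right_mono) (auto simp: C_def)
      finally show "(\<integral>\<^sup>+p. k p \<partial>lborel) \<le> ennreal (C * \<rho> powr (n + 2 - a))" .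
      show "ennreal (Cf * \<rho> powr (- a)) \<le> ennreal (C * \<rho> powr (- a))"
        using Ck(1) by (intro ennreal_leI mult_right_mono) (auto simp: C_def)
    qed auto
    finally show "(\<integral>\<^sup>+p. ennreal (heat_kernel (x - fst p) (t - snd p) powr (a / real DIM('a))) * F p \<partial>lborel)
      \<le> ennreal (C * \<rho> powr (real DIM('a) + 2 - a)) * L
        + ennreal (C * \<rho> powr (- a)) * (\<integral>\<^sup>+p. indicator (UNIV \<times> {..<t}) p * F p \<partial>lborel)"
      unfolding n_def .
  qed
qed

text \<open>This converts integrability up to time 0 into smallness: the strips of times in
  \<open>{0<..<1 / (real k + 1)}\<close> decrease to the empty set, and dominated convergence
  applies.\<close>

lemma small_mass_near_initial_time:
  fixes f :: "'a::euclidean_space \<times> real \<Rightarrow> real"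
  assumes f: "integrable lborel f" and f0: "\<And>p. 0 \<le> f p" and \<eta>: "\<eta> > 0"
  obtains T where "T > 0" "(\<integral>\<^sup>+p. indicator (UNIV \<times> {0<..<T}) p * ennreal (f p) \<partial>lborel) \<le> ennreal \<eta>"
proof -
  define g where "g = (\<lambda>(k::nat) p. indicator (UNIV \<times> {0<..<1 / (real k + 1)}) p * f p)"
  have S: "UNIV \<times> {0<..<1 / (real k + 1)} \<in> sets (borel :: ('a \<times> real) measure)" for k
    by (auto intro!: borel_open open_Times)
  have gi: "integrable lborel (g k)" for k
    using integrable_mult_indicator[of "UNIV \<times> {0<..<1 / (real k + 1)}" lborel f] S f by (simp add: g_def)
  have "(\<lambda>k. \<integral>p. g k p \<partial>lborel) \<longlonglongrightarrow> (\<integral>p. 0 \<partial>(lborel :: ('a \<times> real) measure))"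
  proof (rule integral_dominated_convergence[OF _ _ f])
    show "AE p in lborel. norm (g k p) \<le> f p" for k
      using f0 by (auto simp: g_def indicator_def)
    show "AE p in lborel. (\<lambda>k. g k p) \<longlonglongrightarrow> 0"
    proof (rule AE_I2)
      fix p :: "'a \<times> real"
      have "eventually (\<lambda>k. g k p = 0) sequentially"
      proof (cases "snd p > 0")
        case True
        have "(\<lambda>k. 1 / (real k + 1)) \<longlonglongrightarrow> 0"
          using LIMSEQ_inverse_real_of_nat by (simp add: inverse_eq_divide add.commute)
        from order_tendstoD(2)[OF this True] show ?thesis
          by eventually_elim (auto simp: g_def indicator_def mem_Times_iff)
      qed (auto simp: g_def indicator_def mem_Times_iff)
      then show "(\<lambda>k. g k p) \<longlonglongrightarrow> 0" by (rule tendsto_eventually)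
    qed
  qed (use gi in auto)
  then have "eventually (\<lambda>k. (\<integral>p. g k p \<partial>lborel) < \<eta>) sequentially"
    using \<eta> by (intro order_tendstoD(2)) auto
  then obtain k where k: "(\<integral>p. g k p \<partial>lborel) < \<eta>" by (auto simp: eventually_sequentially)
  have "(\<integral>\<^sup>+p. indicator (UNIV \<times> {0<..<1 / (real k + 1)}) p * ennreal (f p) \<partial>lborel) = (\<integral>\<^sup>+p. ennreal (g k p) \<partial>lborel)"
    by (rule nn_integral_cong) (auto simp: g_def indicator_def)
  also have "\<dots> = ennreal (\<integral>p. g k p \<partial>lborel)"
    by (rule nn_integral_eq_integral[OF gi]) (use f0 in \<open>auto simp: g_def\<close>)
  also have "\<dots> \<le> ennreal \<eta>" using k by (intro ennreal_leI) auto
  finally show thesis by (intro that[of "1 / (real k + 1)"]) auto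
qed

lemma parabolic_derivs_rescale:
  fixes u :: "'a::euclidean_space \<Rightarrow> real \<Rightarrow> real" and x :: 'a and \<rho> t :: real
  assumes u: "C21_on u UNIV J" and M: "M \<noteq> 0"
  defines "X \<equiv> \<lambda>p. x + \<rho> *\<^sub>R fst p" and "\<Theta> \<equiv> \<lambda>p. t + \<rho>\<^sup>2 * snd p"
  shows "parabolic_derivs {s. t + \<rho>\<^sup>2 * s \<in> J} (\<lambda>p. u (X p) (\<Theta> p) / M)
     (\<lambda>i p. \<rho> * dx u i (X p) (\<Theta> p) / M) (\<lambda>i p. \<rho>\<^sup>2 * dx (dx u i) i (X p) (\<Theta> p) / M)
     (\<lambda>p. \<rho>\<^sup>2 * dt u (X p) (\<Theta> p) / M)"
proof -
  have lin: "((\<lambda>h. \<rho> * h) has_real_derivative \<rho>) (at 0)"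
    by (auto intro!: derivative_eq_intros)
  have dX: "((\<lambda>h. f (x + \<rho> *\<^sub>R (y + h *\<^sub>R i)) \<tau>) has_real_derivative \<rho> * f' ) (at 0)"
    if "((\<lambda>h. f ((x + \<rho> *\<^sub>R y) + h *\<^sub>R i) \<tau>) has_real_derivative f') (at 0)" for f :: "'a \<Rightarrow> real \<Rightarrow> real" and f' y i \<tau>
    using DERIV_chain2[of "\<lambda>h. f ((x + \<rho> *\<^sub>R y) + h *\<^sub>R i) \<tau>" f' "\<lambda>h. \<rho> * h" 0, OF _ lin] that
    by (simp add: algebra_simps)
  have dT: "((\<lambda>h. u z (t + \<rho>\<^sup>2 * (s + h))) has_real_derivative \<rho>\<^sup>2 * f') (at 0)"
    if "((\<lambda>s. u z s) has_real_derivative f') (at (t + \<rho>\<^sup>2 * s))" for z s f'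
  proof -
    have "((\<lambda>h. t + \<rho>\<^sup>2 * (s + h)) has_real_derivative \<rho>\<^sup>2) (at 0)"
      by (auto intro!: derivative_eq_intros)
    from DERIV_chain2[of "u z" f' "\<lambda>h. t + \<rho>\<^sup>2 * (s + h)" 0, OF _ this] that
    show ?thesis by (simp add: mult.commute)
  qed
  have cont: "continuous_on (UNIV \<times> {s. t + \<rho>\<^sup>2 * s \<in> J}) (\<lambda>p. f (X p) (\<Theta> p))"
    if "continuous_on (UNIV \<times> J) (\<lambda>p. f (fst p) (snd p))" for f :: "'a \<Rightarrow> real \<Rightarrow> real"
  proof -
    have "continuous_on (UNIV \<times> {s. t + \<rho>\<^sup>2 * s \<in> J}) (\<lambda>p. (\<lambda>p. f (fst p) (snd p)) (X p, \<Theta> p))"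
      unfolding X_def \<Theta>_def
      by (rule continuous_on_compose2[OF that]) (auto intro!: continuous_intros)
    then show ?thesis by simp
  qed
  show ?thesis
    unfolding parabolic_derivs_def
  proof (intro conjI ballI allI impI)
    fix i :: 'a and p :: "'a \<times> real" assume i: "i \<in> Basis" and p: "snd p \<in> {s. t + \<rho>\<^sup>2 * s \<in> J}"
    have "((\<lambda>h. u (x + \<rho> *\<^sub>R (fst p + h *\<^sub>R i)) (\<Theta> p)) has_real_derivative \<rho> * dx u i (X p) (\<Theta> p)) (at 0)"
      by (rule dX) (use u i p in \<open>auto simp: C21_on_def X_def \<Theta>_def\<close>)
    from DERIV_cdivide[OF this, of M]
    show "((\<lambda>h. u (X (p + h *\<^sub>R (i, 0))) (\<Theta> (p + h *\<^sub>R (i, 0))) / M) has_real_derivative \<rho> * dx u i (X p) (\<Theta> p) / M) (at 0)"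
      by (simp add: X_def \<Theta>_def)
    have "((\<lambda>h. dx u i (x + \<rho> *\<^sub>R (fst p + h *\<^sub>R i)) (\<Theta> p)) has_real_derivative \<rho> * dx (dx u i) i (X p) (\<Theta> p)) (at 0)"
      by (rule dX) (use u i p in \<open>auto simp: C21_on_def X_def \<Theta>_def\<close>)
    from DERIV_cdivide[OF DERIV_cmult[OF this, of \<rho>], of M]
    show "((\<lambda>h. \<rho> * dx u i (X (p + h *\<^sub>R (i, 0))) (\<Theta> (p + h *\<^sub>R (i, 0))) / M) has_real_derivative \<rho>\<^sup>2 * dx (dx u i) i (X p) (\<Theta> p) / M) (at 0)"
      by (simp add: X_def \<Theta>_def power2_eq_square mult.assoc)
  next
    fix p :: "'a \<times> real" assume p: "snd p \<in> {s. t + \<rho>\<^sup>2 * s \<in> J}"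
    have "((\<lambda>h. u (X p) (t + \<rho>\<^sup>2 * (snd p + h))) has_real_derivative \<rho>\<^sup>2 * dt u (X p) (\<Theta> p)) (at 0)"
      by (rule dT) (use u p in \<open>auto simp: C21_on_def X_def \<Theta>_def\<close>)
    from DERIV_cdivide[OF this, of M]
    show "((\<lambda>h. u (X (p + h *\<^sub>R (0, 1))) (\<Theta> (p + h *\<^sub>R (0, 1))) / M) has_real_derivative \<rho>\<^sup>2 * dt u (X p) (\<Theta> p) / M) (at 0)"
      by (simp add: X_def \<Theta>_def)
  qed (use u M in \<open>auto simp: C21_on_def intro!: continuous_intros cont\<close>)
qed

section \<open>Decay at the initial time\<close>

text \<open>Plays the part of Hoelder's inequality: values above \<open>\<delta>\<close> are paid
  for by \<open>v powr p\<close>. It turns smallness of the integral of \<open>w powr lam\<close>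
  into smallness of the integral of \<open>w\<close>, up to \<open>\<delta>\<close> times the volume
  of the cylinder.\<close>

lemma le_add_powr:
  fixes v \<delta> p :: real
  assumes "0 \<le> v" "0 < \<delta>" "1 \<le> p"
  shows "v \<le> \<delta> + \<delta> powr (1 - p) * v powr p"
proof (cases "v \<le> \<delta>")
  case True
  then show ?thesis by (simp add: add_increasing2)
next
  case False
  then have "v = v powr (1 - p) * v powr p" using assms by (simp add: powr_add[symmetric])
  also have "\<dots> \<le> \<delta> powr (1 - p) * v powr p"
    using False assms by (intro mult_right_mono powr_mono2') auto
  finally show ?thesis using assms by linarith
qed

text \<open>The weight \<open>D\<close> is a parabolic distance to the lateral boundary and the
  initial time. It vanishes there, so a positive maximum is attained away from both. On the smaller
  cylinder it is still at least \<open>d/2\<close>, so comparison with the maximum costs only the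
  factor \<open>2 powr \<gamma>\<close>.\<close>

lemma weighted_maximum_point:
  fixes u :: "'a::euclidean_space \<Rightarrow> real \<Rightarrow> real"
  assumes cont: "continuous_on (cball 0 2 \<times> {t0..t}) (\<lambda>p. u (fst p) (snd p))"
    and nonneg: "\<And>x t. 0 \<le> u x t" and \<gamma>: "\<gamma> > 0" and \<epsilon>: "\<epsilon> > 0"
    and t: "t0 < t" "t - t0 \<le> 1" and x: "norm x \<le> 1"
    and big: "\<epsilon> < (t - t0) powr (\<gamma> / 2) * u x t"
  obtains x' t' d where "d > 0" "norm x' + d \<le> 2" "t0 + d\<^sup>2 \<le> t'" "t' \<le> t" "\<epsilon> < d powr \<gamma> * u x' t'"
    "\<And>y s. norm (y - x') \<le> d/2 \<Longrightarrow> t' - d\<^sup>2/2 \<le> s \<Longrightarrow> s \<le> t' \<Longrightarrow> u y s \<le> 2 powr \<gamma> * u x' t'"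
proof -
  define S where "S = cball (0::'a) 2 \<times> {t0..t}"
  define D where "D = (\<lambda>p::'a \<times> real. min (2 - norm (fst p)) (sqrt (snd p - t0)))"
  define F where "F = (\<lambda>p. D p powr \<gamma> * u (fst p) (snd p))"
  have D0: "0 \<le> D p" if "p \<in> S" for p using that by (auto simp: S_def D_def)
  have cD: "continuous_on S D" unfolding D_def by (intro continuous_intros)
  have "continuous_on S F"
    unfolding F_def
    by (intro continuous_on_mult continuous_on_powr' cD continuous_on_const cont[folded S_def]) (use D0 \<gamma> in auto)
  moreover have "compact S" by (simp add: S_def compact_Times)
  moreover have xt: "(x, t) \<in> S" using t x by (auto simp: S_def)
  ultimately obtain p where p: "p \<in> S" "\<And>q. q \<in> S \<Longrightarrow> F q \<le> F p"
    using continuous_attains_sup[of S F] by blast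
  obtain x' t' where p': "p = (x', t')" by (cases p)
  define d where "d = D p"
  \<comment> \<open>Since \<open>norm x \<le> 1\<close> and \<open>t - t0 \<le> 1\<close>, the
    minimum is the time term, and the weight at \<open>(x, t)\<close> is exactly the one in
    \<open>big\<close>.\<close>
  have "D (x, t) = sqrt (t - t0)"
  proof -
    have "sqrt (t - t0) \<le> 1" using t by simp
    then have "sqrt (t - t0) \<le> 2 - norm x" using x by linarith
    then show ?thesis by (simp add: D_def min_absorb2)
  qed
  then have "F (x, t) = (t - t0) powr (\<gamma> / 2) * u x t"
    using t by (simp add: F_def powr_half_sqrt[symmetric] powr_powr)
  then have "\<epsilon> < F p" using p(2)[OF xt] big by linarith
  then have Fp: "\<epsilon> < d powr \<gamma> * u x' t'" by (simp add: F_def d_def p')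
  have d: "d > 0"
  proof -
    have "d \<noteq> 0" using Fp \<epsilon> by auto
    then show ?thesis using D0[OF p(1)] by (simp add: d_def)
  qed
  have d1: "norm x' + d \<le> 2" by (auto simp: d_def D_def p')
  have t': "t0 \<le> t'" "t' \<le> t" using p(1) by (auto simp: p' S_def)
  have "d \<le> sqrt (t' - t0)" by (simp add: d_def D_def p')
  then have "d\<^sup>2 \<le> (sqrt (t' - t0))\<^sup>2" using d by (intro power_mono) auto
  then have d2: "t0 + d\<^sup>2 \<le> t'" using t' by simp
  show thesis
  proof (rule that[OF d d1 d2 t'(2) Fp])
    fix y :: 'a and s :: real assume y: "norm (y - x') \<le> d/2" and s: "t' - d\<^sup>2/2 \<le> s" "s \<le> t'"
    have ny: "norm y \<le> norm x' + d/2" using y norm_triangle_sub[of y x'] by linarith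
    \<comment> \<open>Going back in time by \<open>d\<^sup>2/2\<close> leaves at least
      \<open>d\<^sup>2/2\<close> above \<open>t0\<close>, and this is no less than
      \<open>(d/2)\<^sup>2\<close>.\<close>
    have "d\<^sup>2 / 2 \<le> s - t0" using s d2 by linarith
    moreover have "(d/2)\<^sup>2 \<le> d\<^sup>2/2" by (simp add: power_divide)
    ultimately have sd: "d/2 \<le> sqrt (s - t0)" by (intro real_le_rsqrt) linarith
    have "s \<ge> t0" using \<open>d\<^sup>2 / 2 \<le> s - t0\<close> zero_le_power2[of d] by linarith
    then have inS: "(y, s) \<in> S" using ny d1 d s t' by (auto simp: S_def)
    have "d/2 \<le> D (y, s)" using ny d1 sd by (simp add: D_def)
    then have "(d/2) powr \<gamma> * u y s \<le> D (y, s) powr \<gamma> * u y s"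
      using d \<gamma> nonneg by (intro mult_right_mono powr_mono2) auto
    also have "\<dots> \<le> d powr \<gamma> * u x' t'" using p(2)[OF inS] by (simp add: F_def d_def p')
    finally have "d powr \<gamma> * u y s \<le> d powr \<gamma> * (2 powr \<gamma> * u x' t')"
      using d by (simp add: powr_divide field_simps)
    then show "u y s \<le> 2 powr \<gamma> * u x' t'" using d by simp
  qed
qed

text \<open>The point is uniformity: \<open>T\<close> is fixed before \<open>x\<close>, as a
  supremum over the unit ball requires.\<close>

lemma uniform_initial_decay:
  fixes u :: "'a::euclidean_space \<Rightarrow> real \<Rightarrow> real"
    and alpha lam sigma :: real
  assumes alpha: "0 < alpha" "alpha < real DIM('a) + 2"
    and lam: "1 \<le> lam"
    and sigma: "0 \<le> sigma" "sigma < 1 - (alpha - 2) / (real DIM('a) + 2) * lam"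
    and nonneg: "\<And>x t. 0 \<le> u x t"
    and reg: "C21_on u UNIV {0<..<16}"
    and Lp: "set_integrable lborel (UNIV \<times> {0<..<16::real}) (\<lambda>p. u (fst p) (snd p) powr lam)"
    and ineq: "\<And>x t. x \<in> ball 0 4 \<Longrightarrow> t \<in> {0<..<16} \<Longrightarrow>
        ennreal (dt u x t - laplacian u x t) \<le>
          (\<integral>\<^sup>+ p. indicator (UNIV \<times> {0<..<16}) p *
              ennreal (heat_kernel (x - fst p) (t - snd p) powr (alpha / real DIM('a))
                       * u (fst p) (snd p) powr lam) \<partial>lborel)
          * ennreal (npow (u x t) sigma)"
    and \<epsilon>: "\<epsilon> > 0"
  obtains T where "T > 0"
    "\<And>x t. norm x \<le> 1 \<Longrightarrow> 0 < t \<Longrightarrow> t < T \<Longrightarrow> t powr ((real DIM('a) + 2) / (2 * lam)) * u x t \<le> \<epsilon>"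
proof -
  define n where "n = real DIM('a)"
  have n: "n > 0" by (simp add: n_def)
  define \<gamma> where "\<gamma> = (n + 2) / lam"
  have \<gamma>: "\<gamma> > 0" using n lam by (simp add: \<gamma>_def)
  have \<gamma>lam: "\<gamma> * lam = n + 2" using lam by (simp add: \<gamma>_def)
  define K where "K = 2 powr \<gamma>"
  have K: "K > 0" by (simp add: K_def)
  \<comment> \<open>The total power of \<open>\<rho>\<close> in the rescaled right-hand side: 2 from
    the scaling, \<open>- alpha\<close> from the potential and \<open>\<gamma> * (1 - sigma)\<close>
    from \<open>M powr (sigma - 1)\<close>.\<close>
  define e where "e = 2 - alpha + \<gamma> * (1 - sigma)"
  have e: "e > 0"
  proof -
    have "\<gamma> * ((alpha - 2) / (n + 2) * lam) = alpha - 2" using n lam by (simp add: \<gamma>_def)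
    moreover have "\<gamma> * ((alpha - 2) / (n + 2) * lam) < \<gamma> * (1 - sigma)"
      using sigma(2) \<gamma> by (intro mult_strict_left_mono) (auto simp: n_def)
    ultimately show ?thesis by (simp add: e_def)
  qed
  \<comment> \<open>The eventual lower bound for \<open>a\<close>: either
    \<open>\<mu> = 1/4\<close>, which gives \<open>a > 4 powr (- \<gamma>) * \<epsilon>\<close>, or
    \<open>a = 1\<close>.\<close>
  define c0 where "c0 = min (4 powr (- \<gamma>) * \<epsilon>) 1"
  have c0: "c0 > 0" "c0 \<le> 1" using \<epsilon> by (auto simp: c0_def)
  define Q where "Q = cball (0::'a) 1 \<times> {-1..0::real}"
  have Qc: "compact Q" by (simp add: Q_def compact_Times)
  obtain Cm where Cm: "Cm > 0" and mean:
    "\<And>(w :: 'a \<times> real \<Rightarrow> real) wx wxx wt I A.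
      open I \<Longrightarrow> {-1..0} \<subseteq> I \<Longrightarrow> parabolic_derivs I w wx wxx wt \<Longrightarrow> (\<And>p. 0 \<le> w p) \<Longrightarrow> 0 \<le> A \<Longrightarrow>
      (\<And>p. p \<in> Q \<Longrightarrow> wt p - (\<Sum>i\<in>Basis. wxx i p) \<le> A) \<Longrightarrow>
      w (0, 0) \<le> Cm * (A + (\<integral>p. indicator Q p * w p \<partial>lborel))"
    unfolding Q_def by (rule heat_subsolution_mean_value[where 'a='a]) blast
  obtain Cv where Cv: "Cv \<ge> 0" and pot:
    "\<And>(F :: 'a \<times> real \<Rightarrow> ennreal) x t \<rho> L.
      F \<in> borel_measurable borel \<Longrightarrow> \<rho> > 0 \<Longrightarrow>
      (\<And>y s. norm (x - y) \<le> \<rho> \<Longrightarrow> t - \<rho>\<^sup>2 < s \<Longrightarrow> s < t \<Longrightarrow> F (y, s) \<le> L) \<Longrightarrow>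
      (\<integral>\<^sup>+p. ennreal (heat_kernel (x - fst p) (t - snd p) powr (alpha / n)) * F p \<partial>lborel)
      \<le> ennreal (Cv * \<rho> powr (n + 2 - alpha)) * L
        + ennreal (Cv * \<rho> powr (- alpha)) * (\<integral>\<^sup>+p. indicator (UNIV \<times> {..<t}) p * F p \<partial>lborel)"
    unfolding n_def by (rule heat_potential_bound[OF alpha]) blast
  define V where "V = measure lborel Q"
  have V: "V \<ge> 0" by (simp add: V_def)
  \<comment> \<open>The mean value inequality will bound 1 by \<open>Cm\<close> times a sum of three
    terms. The constants \<open>\<delta>\<close>, \<open>\<eta>\<close> and \<open>T\<close>, chosen
    in this order, keep each contribution at most 1/4, for a total of 3/4.\<close>
  define \<delta> where "\<delta> = 1 / (4 * Cm * (V + 1))"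
  have \<delta>: "\<delta> > 0" using Cm V by (simp add: \<delta>_def)
  have \<delta>V: "Cm * (\<delta> * V) \<le> 1/4"
  proof -
    have "Cm * (\<delta> * V) = V / (4 * (V + 1))" using Cm by (simp add: \<delta>_def)
    also have "\<dots> \<le> 1/4" using V by (simp add: field_simps)
    finally show ?thesis .
  qed
  \<comment> \<open>The first factor comes from \<open>le_add_powr\<close> at level
    \<open>\<delta>\<close>, the second bounds the \<open>a powr (- lam)\<close> left over by the
    change of variables.\<close>
  define E where "E = \<delta> powr (1 - lam) * c0 powr (- lam)"
  have E: "E > 0" using \<delta> c0 by (simp add: E_def)
  define \<eta> where "\<eta> = min 1 (1 / (4 * Cm * E))"
  have \<eta>: "\<eta> > 0" "\<eta> \<le> 1" using Cm E by (auto simp: \<eta>_def)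
  have \<eta>E: "Cm * (E * \<eta>) \<le> 1/4"
  proof -
    have "\<eta> \<le> 1 / (4 * Cm * E)" by (simp add: \<eta>_def)
    then have "Cm * E * \<eta> \<le> Cm * E * (1 / (4 * Cm * E))" using Cm E by (intro mult_left_mono) auto
    also have "\<dots> = 1/4" using Cm E by simp
    finally show ?thesis by (simp add: mult.assoc)
  qed
  define f where "f = (\<lambda>p::'a \<times> real. indicator (UNIV \<times> {0<..<16}) p * u (fst p) (snd p) powr lam)"
  have f: "integrable lborel f" using Lp by (simp add: set_integrable_def f_def)
  have f0: "0 \<le> f p" for p by (simp add: f_def)
  have fm: "(\<lambda>p. ennreal (f p)) \<in> borel_measurable borel"
    using f by (intro measurable_compose[OF _ measurable_ennreal]) auto
  obtain T0 where T0: "T0 > 0" "(\<integral>\<^sup>+p. indicator (UNIV \<times> {0<..<T0}) p * ennreal (f p) \<partial>lborel) \<le> ennreal \<eta>"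
    using small_mass_near_initial_time[OF f f0 \<eta>(1)] .
  \<comment> \<open>The bracket covers both signs of \<open>sigma - 1\<close>; the last summand
    makes \<open>B0\<close> positive, so that \<open>T\<close> can be defined by dividing by
    it.\<close>
  define B0 where "B0 = Cv * (K powr lam + 1) * K powr sigma * (1 + c0 powr (sigma - 1)) + 1"
  have B0: "B0 > 0" using Cv by (auto simp: B0_def intro!: add_nonneg_pos)
  define T where "T = min (min T0 1) ((1 / (4 * Cm * B0)) powr (2 / e))"
  have T: "T > 0" "T \<le> T0" "T \<le> 1" using T0 Cm B0 by (auto simp: T_def)
  have TB: "Cm * (B0 * T powr (e/2)) \<le> 1/4"
  proof -
    have "T powr (e/2) \<le> ((1 / (4 * Cm * B0)) powr (2 / e)) powr (e/2)"
      using T e by (intro powr_mono2) (auto simp: T_def)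
    also have "\<dots> = 1 / (4 * Cm * B0)" using e Cm B0 by (simp add: powr_powr)
    finally have "Cm * B0 * T powr (e/2) \<le> Cm * B0 * (1 / (4 * Cm * B0))"
      using Cm B0 by (intro mult_left_mono) auto
    also have "\<dots> = 1/4" using Cm B0 by simp
    finally show ?thesis by (simp add: mult.assoc)
  qed
  define H where "H = (\<lambda>p. indicator (UNIV \<times> {0<..<T}) p * ennreal (f p))"
  have Hm: "H \<in> borel_measurable borel"
    unfolding H_def by (intro borel_measurable_times_ennreal borel_measurable_indicator fm) (auto intro!: borel_open open_Times)
  have Hint: "(\<integral>\<^sup>+p. H p \<partial>lborel) \<le> ennreal \<eta>"
  proof -
    have "(\<integral>\<^sup>+p. H p \<partial>lborel) \<le> (\<integral>\<^sup>+p. indicator (UNIV \<times> {0<..<T0}) p * ennreal (f p) \<partial>lborel)"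
      unfolding H_def using T by (intro nn_integral_mono) (auto simp: indicator_def)
    then show ?thesis using T0(2) by (rule order_trans)
  qed
  have cu: "continuous_on (UNIV \<times> {0<..<16}) (\<lambda>p. u (fst p) (snd p))"
    using reg by (simp add: C21_on_def)

  have core: "(t - t0) powr (\<gamma> / 2) * u x t \<le> \<epsilon>" if x: "norm x \<le> 1" and t0: "0 < t0" "t0 < t" and t: "t < T" for x t t0
  proof (rule ccontr)
    assume "\<not> (t - t0) powr (\<gamma> / 2) * u x t \<le> \<epsilon>"
    then have big: "\<epsilon> < (t - t0) powr (\<gamma> / 2) * u x t" by simp
    have cS: "continuous_on (cball 0 2 \<times> {t0..t}) (\<lambda>p. u (fst p) (snd p))"
      by (rule continuous_on_subset[OF cu]) (use t0 t T in auto)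
    have tt: "t - t0 \<le> 1" using t0 t T by linarith
    obtain x' t' d where d: "d > 0" "norm x' + d \<le> 2" "t0 + d\<^sup>2 \<le> t'" "t' \<le> t"
      and md: "\<epsilon> < d powr \<gamma> * u x' t'"
      and ub: "\<And>y s. norm (y - x') \<le> d/2 \<Longrightarrow> t' - d\<^sup>2/2 \<le> s \<Longrightarrow> s \<le> t' \<Longrightarrow> u y s \<le> K * u x' t'"
      unfolding K_def
      by (rule weighted_maximum_point[where u=u, OF cS nonneg \<gamma> \<epsilon> t0(2) tt x big]) blast
    define M where "M = u x' t'"
    have M: "M > 0"
    proof -
      have "M \<noteq> 0" using md \<epsilon> by (auto simp: M_def)
      then show ?thesis using nonneg[of x' t'] by (simp add: M_def)
    qed
    define m where "m = d powr \<gamma> * M"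
    have m: "m > \<epsilon>" "m > 0" using md \<epsilon> by (auto simp: m_def M_def)
    \<comment> \<open>\<open>m powr (- 1 / \<gamma>)\<close> is the value that would make
      \<open>a = m * \<mu> powr \<gamma>\<close> equal to 1. The cap 1/4 leaves room for two steps
      of size \<open>\<rho>\<close> inside the cylinder where \<open>u\<close> is
      controlled.\<close>
    define \<mu> where "\<mu> = min (1/4) (m powr (- 1 / \<gamma>))"
    have \<mu>: "\<mu> > 0" "\<mu> \<le> 1/4" using m by (auto simp: \<mu>_def)
    define \<rho> where "\<rho> = d * \<mu>"
    have \<rho>: "\<rho> > 0" "\<rho> \<le> d/4" using d \<mu> by (auto simp: \<rho>_def)
    define a where "a = M * \<rho> powr \<gamma>"
    have am: "a = m * \<mu> powr \<gamma>" using d \<mu> by (simp add: a_def m_def \<rho>_def powr_mult)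
    have a: "c0 \<le> a" "a \<le> 1"
    proof -
      have pw: "m * (m powr (- 1 / \<gamma>)) powr \<gamma> = 1"
      proof -
        have "(m powr (- 1 / \<gamma>)) powr \<gamma> = m powr (- 1)" using \<gamma> by (simp add: powr_powr)
        then show ?thesis using m by (simp add: powr_minus)
      qed
      show "a \<le> 1"
      proof -
        have "\<mu> powr \<gamma> \<le> (m powr (- 1 / \<gamma>)) powr \<gamma>" using \<mu> \<gamma> by (intro powr_mono2) (auto simp: \<mu>_def)
        then have "m * \<mu> powr \<gamma> \<le> m * (m powr (- 1 / \<gamma>)) powr \<gamma>" using m by (intro mult_left_mono) auto
        then show ?thesis using pw am by simp
      qed
      show "c0 \<le> a"
      proof (cases "1/4 \<le> m powr (- 1 / \<gamma>)")
        case True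
        then have "a = m * 4 powr (- \<gamma>)" using am by (simp add: \<mu>_def powr_divide powr_minus_divide)
        moreover have "4 powr (- \<gamma>) * \<epsilon> \<le> 4 powr (- \<gamma>) * m" using m by (intro mult_left_mono) auto
        moreover have "c0 \<le> 4 powr (- \<gamma>) * \<epsilon>" by (simp add: c0_def)
        ultimately show ?thesis by (simp only: mult.commute)
      next
        case False
        then have "a = 1" using am pw by (simp add: \<mu>_def)
        then show ?thesis using c0 by simp
      qed
    qed
    have apos: "a > 0" using a c0 by linarith
    have Ma: "M = a * \<rho> powr (- \<gamma>)" using \<rho> by (simp add: a_def powr_minus)
    have alam: "M powr lam * \<rho> powr (n + 2) = a powr lam"
      using M \<rho> by (simp add: a_def powr_mult powr_powr \<gamma>lam)
    have \<rho>d: "\<rho>\<^sup>2 \<le> d\<^sup>2 / 16"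
    proof -
      have "\<rho>\<^sup>2 \<le> (d/4)\<^sup>2" using \<rho> by (intro power_mono) auto
      then show ?thesis by (simp add: power_divide)
    qed
    have d2: "d\<^sup>2 \<ge> 0" by simp
    have d2T: "d\<^sup>2 \<le> T" using d t t0 by linarith
    have \<rho>T: "\<rho> powr e \<le> T powr (e/2)"
    proof -
      have "\<rho>\<^sup>2 \<le> T" using \<rho>d d2 d2T by linarith
      then have "(\<rho>\<^sup>2) powr (e/2) \<le> T powr (e/2)" using e by (intro powr_mono2) auto
      moreover have "(\<rho>\<^sup>2) powr (e/2) = \<rho> powr e"
      proof -
        have "\<rho>\<^sup>2 = \<rho> powr 2" using \<rho> by simp
        then show ?thesis by (simp only: powr_powr) simp
      qed
      ultimately show ?thesis by simp
    qed
    define D where "D = Cv * \<rho> powr (- alpha) * (K powr lam + 1) * (K * M) powr sigma"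
    have D0: "D \<ge> 0" using Cv by (auto simp: D_def)
    have upper: "dt u z r - laplacian u z r \<le> D"
      if z: "norm (z - x') \<le> \<rho>" and r: "t' - \<rho>\<^sup>2 \<le> r" "r \<le> t'" for z r
    proof -
      have "norm z \<le> norm x' + \<rho>" using z norm_triangle_sub[of z x'] by linarith
      then have zb: "z \<in> ball 0 4" using \<rho> d by simp
      have r0: "0 < r" using r d t0 \<rho>d d2 by linarith
      have rT: "r < T" using r d t by linarith
      have rI: "r \<in> {0<..<16}" using r0 rT T by simp
      have uzr: "u z r \<le> K * M"
        unfolding M_def using z r \<rho> \<rho>d d2 by (intro ub) auto
      \<comment> \<open>\<open>(y, s)\<close> is within \<open>2 * \<rho> \<le> d/2\<close> of
        \<open>x'\<close> in space and at most \<open>2 * \<rho>\<^sup>2 \<le> d\<^sup>2/8\<close>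
        before \<open>t'\<close>, so the bound obtained from the maximum applies.\<close>
      have near: "ennreal (f (y, s)) \<le> ennreal ((K * M) powr lam)"
        if "norm (z - y) \<le> \<rho>" "r - \<rho>\<^sup>2 < s" "s < r" for y s
      proof -
        have "norm (y - x') \<le> norm (z - y) + norm (z - x')"
          using norm_triangle_ineq[of "y - z" "z - x'"] by (simp add: norm_minus_commute)
        then have "norm (y - x') \<le> d/2" using that(1) z \<rho> by linarith
        moreover have "t' - d\<^sup>2/2 \<le> s" using that(2) r \<rho>d d2 by linarith
        moreover have "s \<le> t'" using that(3) r by linarith
        ultimately have "u y s \<le> K * M" unfolding M_def by (rule ub)
        then have "u y s powr lam \<le> (K * M) powr lam"
          using nonneg lam by (intro powr_mono2) auto
        then show ?thesis by (intro ennreal_leI) (auto simp: f_def indicator_def)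
      qed
      define P where "P = (\<integral>\<^sup>+p. ennreal (heat_kernel (z - fst p) (r - snd p) powr (alpha / n)) * ennreal (f p) \<partial>lborel)"
      have "P \<le> ennreal (Cv * \<rho> powr (n + 2 - alpha)) * ennreal ((K * M) powr lam)
        + ennreal (Cv * \<rho> powr (- alpha)) * (\<integral>\<^sup>+p. indicator (UNIV \<times> {..<r}) p * ennreal (f p) \<partial>lborel)"
        unfolding P_def by (rule pot[OF fm \<rho>(1) near])
      also have "(\<integral>\<^sup>+p. indicator (UNIV \<times> {..<r}) p * ennreal (f p) \<partial>lborel) \<le> (\<integral>\<^sup>+p. H p \<partial>lborel)"
        using rT by (intro nn_integral_mono) (auto simp: H_def f_def indicator_def)
      \<comment> \<open>Here the mass only has to be bounded; its smallness is used later, for the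
        integral of \<open>w\<close>.\<close>
      also have "(\<integral>\<^sup>+p. H p \<partial>lborel) \<le> ennreal 1"
        using Hint \<eta> by (meson ennreal_leI order_trans)
      also have "ennreal (Cv * \<rho> powr (n + 2 - alpha)) * ennreal ((K * M) powr lam) + ennreal (Cv * \<rho> powr (- alpha)) * ennreal 1
          = ennreal (Cv * \<rho> powr (n + 2 - alpha) * (K * M) powr lam + Cv * \<rho> powr (- alpha))"
        using Cv by (simp add: ennreal_mult ennreal_plus)
      also have "Cv * \<rho> powr (n + 2 - alpha) * (K * M) powr lam + Cv * \<rho> powr (- alpha)
          = Cv * \<rho> powr (- alpha) * (K powr lam * a powr lam + 1)"
      proof -
        have "\<rho> powr (n + 2 - alpha) = \<rho> powr (- alpha) * \<rho> powr (n + 2)"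
          by (simp add: powr_add[symmetric])
        then show ?thesis using K M by (simp add: alam[symmetric] powr_mult algebra_simps)
      qed
      also have "ennreal \<dots> \<le> ennreal (Cv * \<rho> powr (- alpha) * (K powr lam + 1))"
      proof (intro ennreal_leI mult_left_mono add_right_mono)
        have "a powr lam \<le> 1 powr lam" using a apos lam by (intro powr_mono2) auto
        then show "K powr lam * a powr lam \<le> K powr lam" by (simp add: mult_left_le)
      qed (use Cv in auto)
      finally have P: "P \<le> ennreal (Cv * \<rho> powr (- alpha) * (K powr lam + 1))"
        by (simp add: add_left_mono mult_left_mono)
      \<comment> \<open>For \<open>sigma = 0\<close> the value of \<open>npow\<close> is 1 even
        where \<open>u\<close> vanishes, whereas \<open>0 powr 0 = 0\<close>. The comparison
        survives because \<open>K * M\<close> is positive.\<close>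
      have np: "npow (u z r) sigma \<le> (K * M) powr sigma"
        using uzr nonneg[of z r] sigma(1) K M by (auto simp: npow_def intro!: powr_mono2)
      have "ennreal (dt u z r - laplacian u z r) \<le> P * ennreal (npow (u z r) sigma)"
      proof -
        have "P = (\<integral>\<^sup>+ p. indicator (UNIV \<times> {0<..<16}) p *
              ennreal (heat_kernel (z - fst p) (r - snd p) powr (alpha / real DIM('a))
                       * u (fst p) (snd p) powr lam) \<partial>lborel)"
          unfolding P_def n_def by (intro nn_integral_cong) (auto simp: f_def indicator_def ennreal_mult)
        then show ?thesis using ineq[OF zb rI] by simp
      qed
      also have "\<dots> \<le> ennreal (Cv * \<rho> powr (- alpha) * (K powr lam + 1)) * ennreal ((K * M) powr sigma)"
        using P np by (intro mult_mono ennreal_leI) auto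
      also have "\<dots> = ennreal D" using Cv by (simp add: D_def ennreal_mult)
      \<comment> \<open>\<open>ennreal\<close> sends negative reals to 0; nonnegativity of
        \<open>D\<close> is what permits the return to real numbers.\<close>
      finally show ?thesis using D0 by (simp add: ennreal_le_iff)
    qed
    define X where "X = (\<lambda>p::'a \<times> real. x' + \<rho> *\<^sub>R fst p)"
    define \<Theta> where "\<Theta> = (\<lambda>p::'a \<times> real. t' + \<rho>\<^sup>2 * snd p)"
    define w where "w = (\<lambda>p. u (X p) (\<Theta> p) / M)"
    define wxx where "wxx = (\<lambda>i p. \<rho>\<^sup>2 * dx (dx u i) i (X p) (\<Theta> p) / M)"
    define wt where "wt = (\<lambda>p. \<rho>\<^sup>2 * dt u (X p) (\<Theta> p) / M)"
    define I where "I = {s. t' + \<rho>\<^sup>2 * s \<in> {0<..<16::real}}"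
    have pw: "parabolic_derivs I w (\<lambda>i p. \<rho> * dx u i (X p) (\<Theta> p) / M) wxx wt"
      unfolding I_def w_def wxx_def wt_def X_def \<Theta>_def
      by (rule parabolic_derivs_rescale[OF reg]) (use M in auto)
    have inQ: "norm (X p - x') \<le> \<rho>" "t' - \<rho>\<^sup>2 \<le> \<Theta> p" "\<Theta> p \<le> t'" if "p \<in> Q" for p
    proof -
      have p: "norm (fst p) \<le> 1" "-1 \<le> snd p" "snd p \<le> 0" using that by (auto simp: Q_def mem_Times_iff)
      show "norm (X p - x') \<le> \<rho>" using p \<rho> by (simp add: X_def mult_left_le)
      have "\<rho>\<^sup>2 * (-1) \<le> \<rho>\<^sup>2 * snd p" using p by (intro mult_left_mono) auto
      then show "t' - \<rho>\<^sup>2 \<le> \<Theta> p" by (simp add: \<Theta>_def)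
      show "\<Theta> p \<le> t'" using p by (simp add: \<Theta>_def mult_nonneg_nonpos)
    qed
    have Ipre: "0 < \<Theta> p" "\<Theta> p < T" if "p \<in> Q" for p
    proof -
      show "0 < \<Theta> p" using inQ[OF that] d t0 \<rho>d d2 by linarith
      show "\<Theta> p < T" using inQ[OF that] d t by linarith
    qed
    have I1: "open I"
    proof -
      have "I = (\<lambda>s. t' + \<rho>\<^sup>2 * s) -` {0<..<16}" by (auto simp: I_def)
      then show ?thesis by (simp add: open_vimage continuous_intros)
    qed
    have I2: "{-1..0} \<subseteq> I"
    proof
      fix s :: real assume "s \<in> {-1..0}"
      then have "(0, s) \<in> Q" by (simp add: Q_def)
      from Ipre[OF this] show "s \<in> I" using T by (simp add: I_def \<Theta>_def)
    qed
    have w0: "0 \<le> w p" for p using nonneg M by (simp add: w_def)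
    have w1: "w (0, 0) = 1" using M by (simp add: w_def X_def \<Theta>_def M_def)
    define A where "A = B0 * T powr (e/2)"
    have A0: "0 \<le> A" using B0 by (simp add: A_def)
    \<comment> \<open>Writing \<open>M = a * \<rho> powr (- \<gamma>)\<close> collects all powers of
      \<open>\<rho>\<close> into \<open>\<rho> powr e\<close>, at most \<open>T powr (e/2)\<close>
      because \<open>\<rho>\<^sup>2 \<le> T\<close>.\<close>
    have DA: "\<rho>\<^sup>2 / M * D \<le> A"
    proof -
      have "M powr (sigma - 1) = a powr (sigma - 1) * \<rho> powr (\<gamma> * (1 - sigma))"
      proof -
        have "M powr (sigma - 1) = a powr (sigma - 1) * (\<rho> powr (- \<gamma>)) powr (sigma - 1)"
          unfolding Ma using apos by (simp add: powr_mult)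
        also have "(\<rho> powr (- \<gamma>)) powr (sigma - 1) = \<rho> powr (\<gamma> * (1 - sigma))"
          by (simp add: powr_powr algebra_simps)
        finally show ?thesis .
      qed
      moreover have "\<rho>\<^sup>2 = \<rho> powr 2" using \<rho> by simp
      moreover have "M powr sigma / M = M powr (sigma - 1)" using M by (simp add: powr_diff)
      moreover have "\<rho> powr 2 * \<rho> powr (- alpha) * \<rho> powr (\<gamma> * (1 - sigma)) = \<rho> powr e"
        by (simp add: powr_add[symmetric] e_def)
      ultimately have eq: "\<rho>\<^sup>2 * \<rho> powr (- alpha) * (M powr sigma / M) = \<rho> powr e * a powr (sigma - 1)"
        by (metis mult.assoc mult.commute)
      \<comment> \<open>For \<open>alpha < 2\<close> the exponent \<open>sigma\<close> may exceed 1.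
        Then \<open>a \<le> 1\<close> gives the bound; for \<open>sigma < 1\<close> it comes from
        \<open>c0 \<le> a\<close>.\<close>
      have as: "a powr (sigma - 1) \<le> 1 + c0 powr (sigma - 1)"
      proof (cases "sigma \<ge> 1")
        case True
        have "a powr (sigma - 1) \<le> 1 powr (sigma - 1)" using a apos True by (intro powr_mono2) auto
        then show ?thesis by (simp add: add_increasing2)
      next
        case False
        have "a powr (sigma - 1) \<le> c0 powr (sigma - 1)" using a c0 False by (intro powr_mono2') auto
        then show ?thesis by simp
      qed
      have "\<rho>\<^sup>2 / M * D = Cv * (K powr lam + 1) * K powr sigma * (\<rho>\<^sup>2 * \<rho> powr (- alpha) * (M powr sigma / M))"
        using K M by (simp add: D_def powr_mult)
      also have "\<dots> = Cv * (K powr lam + 1) * K powr sigma * (\<rho> powr e * a powr (sigma - 1))"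
        by (simp only: eq)
      also have "\<dots> \<le> Cv * (K powr lam + 1) * K powr sigma * (T powr (e/2) * (1 + c0 powr (sigma - 1)))"
        using \<rho>T as Cv by (intro mult_left_mono mult_mono) auto
      also have "\<dots> = (B0 - 1) * T powr (e/2)" by (simp add: B0_def mult_ac)
      also have "\<dots> \<le> A" unfolding A_def by (intro mult_right_mono) auto
      finally show ?thesis .
    qed
    have sub: "wt p - (\<Sum>i\<in>Basis. wxx i p) \<le> A" if p: "p \<in> Q" for p
    proof -
      have "wt p - (\<Sum>i\<in>Basis. wxx i p) = \<rho>\<^sup>2 / M * (dt u (X p) (\<Theta> p) - laplacian u (X p) (\<Theta> p))"
        by (simp add: wt_def wxx_def laplacian_def right_diff_distrib sum_distrib_left sum_divide_distrib)
      also have "\<dots> \<le> \<rho>\<^sup>2 / M * D" using upper[OF inQ[OF p]] M by (intro mult_left_mono) auto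
      finally show ?thesis using DA by simp
    qed
    \<comment> \<open>Returning to the variables of \<open>u\<close> costs
      \<open>\<rho> powr (- (n + 2))\<close>, which together with \<open>M powr (- lam)\<close> is
      exactly \<open>a powr (- lam)\<close>. The image of \<open>Q\<close> lies in times between 0
      and \<open>T\<close>, where the mass is at most \<open>\<eta>\<close>.\<close>
    have int: "(\<integral>p. indicator Q p * w p \<partial>lborel) \<le> \<delta> * V + E * \<eta>"
    proof -
      define Y where "Y = (\<integral>\<^sup>+p. H (X p, \<Theta> p) \<partial>lborel)"
      have HXm: "(\<lambda>p. H (X p, \<Theta> p)) \<in> borel_measurable borel"
        unfolding X_def \<Theta>_def
        by (rule measurable_compose[OF _ Hm])
           (auto intro!: borel_measurable_continuous_onI continuous_intros)
      have Y: "Y \<le> ennreal (\<rho> powr (- (n + 2)) * \<eta>)"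
      proof -
        have "ennreal (\<rho> powr (n + 2)) * Y = (\<integral>\<^sup>+p. H p \<partial>lborel)"
          unfolding Y_def X_def \<Theta>_def n_def
          by (rule nn_integral_lborel_parabolic_affine[OF Hm \<rho>(1), symmetric])
        then have "ennreal (\<rho> powr (- (n + 2))) * (ennreal (\<rho> powr (n + 2)) * Y) \<le> ennreal (\<rho> powr (- (n + 2))) * ennreal \<eta>"
          using Hint by (intro mult_left_mono) auto
        moreover have "ennreal (\<rho> powr (- (n + 2))) * (ennreal (\<rho> powr (n + 2)) * Y) = Y"
        proof -
          have "\<rho> powr (- (n + 2)) * \<rho> powr (n + 2) = 1" using \<rho> by (simp add: powr_add[symmetric])
          then have "ennreal (\<rho> powr (- (n + 2))) * ennreal (\<rho> powr (n + 2)) = 1"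
            by (simp add: ennreal_mult[symmetric])
          then show ?thesis by (simp add: mult.assoc[symmetric])
        qed
        ultimately show ?thesis using \<eta> by (simp add: ennreal_mult)
      qed
      define b where "b = \<delta> powr (1 - lam) * M powr (- lam)"
      have b: "b \<ge> 0" by (simp add: b_def)
      have pt: "ennreal (indicator Q p * w p) \<le> ennreal \<delta> * indicator Q p + ennreal b * H (X p, \<Theta> p)" for p
      proof (cases "p \<in> Q")
        case True
        have "w p \<le> \<delta> + \<delta> powr (1 - lam) * w p powr lam" by (rule le_add_powr[OF w0 \<delta> lam])
        also have "w p powr lam = u (X p) (\<Theta> p) powr lam * M powr (- lam)"
          using M nonneg by (simp add: w_def powr_divide powr_minus_divide)
        finally have "w p \<le> \<delta> + b * u (X p) (\<Theta> p) powr lam" by (simp add: b_def mult_ac)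
        moreover have "H (X p, \<Theta> p) = ennreal (u (X p) (\<Theta> p) powr lam)"
          using Ipre[OF True] T by (simp add: H_def f_def)
        ultimately show ?thesis using True b \<delta>
          by (simp add: ennreal_mult[symmetric] ennreal_plus[symmetric] ennreal_leI del: ennreal_plus)
      qed simp
      have Qs: "Q \<in> sets borel" using Qc by (simp add: borel_compact)
      have Vf: "emeasure lborel Q = ennreal V"
        unfolding V_def using emeasure_compact_finite[OF Qc] by (simp add: emeasure_eq_ennreal_measure)
      have "(\<integral>\<^sup>+p. ennreal (indicator Q p * w p) \<partial>lborel) \<le> (\<integral>\<^sup>+p. ennreal \<delta> * indicator Q p + ennreal b * H (X p, \<Theta> p) \<partial>lborel)"
        by (rule nn_integral_mono) (rule pt)
      also have "\<dots> = (\<integral>\<^sup>+p. ennreal \<delta> * indicator Q p \<partial>lborel) + (\<integral>\<^sup>+p. ennreal b * H (X p, \<Theta> p) \<partial>lborel)"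
        by (rule nn_integral_add) (use HXm Qs in \<open>auto intro!: borel_measurable_times_ennreal\<close>)
      also have "(\<integral>\<^sup>+p. ennreal \<delta> * indicator Q p \<partial>lborel) = ennreal (\<delta> * V)"
        using Qs \<delta> V by (simp add: nn_integral_cmult_indicator Vf ennreal_mult)
      also have "(\<integral>\<^sup>+p. ennreal b * H (X p, \<Theta> p) \<partial>lborel) = ennreal b * Y"
        unfolding Y_def by (rule nn_integral_cmult) (use HXm in auto)
      also have "ennreal b * Y \<le> ennreal b * ennreal (\<rho> powr (- (n + 2)) * \<eta>)"
        using Y by (intro mult_left_mono) auto
      also have "\<dots> = ennreal (b * (\<rho> powr (- (n + 2)) * \<eta>))" using b \<eta> by (simp add: ennreal_mult)
      also have "b * (\<rho> powr (- (n + 2)) * \<eta>) \<le> E * \<eta>"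
      proof -
        have "M powr (- lam) * \<rho> powr (- (n + 2)) = a powr (- lam)"
          by (simp only: powr_minus alam[symmetric] inverse_mult_distrib)
        moreover have "a powr (- lam) \<le> c0 powr (- lam)" using a c0 lam by (intro powr_mono2') auto
        ultimately have "\<delta> powr (1 - lam) * (M powr (- lam) * \<rho> powr (- (n + 2))) \<le> E"
          unfolding E_def by (intro mult_left_mono) auto
        then have "\<delta> powr (1 - lam) * (M powr (- lam) * \<rho> powr (- (n + 2))) * \<eta> \<le> E * \<eta>"
          using \<eta> by (intro mult_right_mono) auto
        then show ?thesis by (simp add: b_def mult.assoc)
      qed
      finally have "(\<integral>\<^sup>+p. ennreal (indicator Q p * w p) \<partial>lborel) \<le> ennreal (\<delta> * V) + ennreal (E * \<eta>)"
        by (simp add: add_left_mono ennreal_leI)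
      also have "\<dots> = ennreal (\<delta> * V + E * \<eta>)" using \<delta> V E \<eta> by (simp add: ennreal_plus)
      finally show ?thesis using \<delta> V E \<eta> by (intro integral_real_bounded) auto
    qed
    have "1 \<le> Cm * (A + (\<integral>p. indicator Q p * w p \<partial>lborel))"
      using mean[OF I1 I2 pw w0 A0 sub] w1 by simp
    also have "\<dots> \<le> Cm * (A + (\<delta> * V + E * \<eta>))" using int Cm by (intro mult_left_mono) auto
    also have "\<dots> \<le> 3/4" using TB \<delta>V \<eta>E by (simp add: A_def distrib_left)
    finally show False by simp
  qed
  show thesis
  proof (rule that[OF T(1)])
    fix x :: 'a and t :: real assume x: "norm x \<le> 1" and t: "0 < t" "t < T"
    \<comment> \<open>\<open>core\<close> holds for all small positive \<open>t0\<close> with the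
      same \<open>\<epsilon>\<close>, and the weight is continuous at \<open>t0 = 0\<close>, so the
      bound passes to the limit.\<close>
    have "((\<lambda>t0. (t - t0) powr (\<gamma> / 2) * u x t) \<longlongrightarrow> (t - 0) powr (\<gamma> / 2) * u x t) (at_right 0)"
      using t by (intro tendsto_intros) auto
    moreover have "eventually (\<lambda>t0. (t - t0) powr (\<gamma> / 2) * u x t \<le> \<epsilon>) (at_right 0)"
      using core[OF x] t by (auto simp: eventually_at_right_field)
    ultimately have "(t - 0) powr (\<gamma> / 2) * u x t \<le> \<epsilon>"
      by (intro tendsto_upperbound) auto
    then show "t powr ((real DIM('a) + 2) / (2 * lam)) * u x t \<le> \<epsilon>"
      by (simp add: \<gamma>_def n_def mult.commute)
  qed
qed

section \<open>From the uniform bound to the little-o statement\<close>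

theorem theorem5p1:
  fixes u :: "'a::euclidean_space \<Rightarrow> real \<Rightarrow> real"
    and alpha lam sigma :: real
  assumes "0 < alpha" and "alpha < real DIM('a) + 2"
    and "lam \<ge> (real DIM('a) + 2) / real DIM('a)"
    and "0 \<le> sigma" and "sigma < 1 - (alpha - 2) / (real DIM('a) + 2) * lam"
    and nonneg: "\<And>x t. 0 \<le> u x t"
    and reg: "C21_on u UNIV {0<..<16}"
    and Lp: "set_integrable lborel (UNIV \<times> {0<..<16::real}) (\<lambda>p. u (fst p) (snd p) powr lam)"
    and ineq: "\<And>x t. x \<in> ball 0 4 \<Longrightarrow> t \<in> {0<..<16} \<Longrightarrow>
        0 \<le> dt u x t - laplacian u x t \<and>
        ennreal (dt u x t - laplacian u x t) \<le>
          (\<integral>\<^sup>+ p. indicator (UNIV \<times> {0<..<16}) p *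
              ennreal (heat_kernel (x - fst p) (t - snd p) powr (alpha / real DIM('a))
                       * u (fst p) (snd p) powr lam) \<partial>lborel)
          * ennreal (npow (u x t) sigma)"
  shows "(\<lambda>t. SUP x\<in>cball 0 1. u x t) \<in> o[at_right 0](\<lambda>t. t powr (- (real DIM('a) + 2) / (2 * lam)))"
proof (rule landau_o.smallI)
  fix c :: real assume c: "c > 0"
  have "1 \<le> (real DIM('a) + 2) / real DIM('a)" by simp
  then have lam: "1 \<le> lam" using assms(3) by linarith
  define \<beta> where "\<beta> = (real DIM('a) + 2) / (2 * lam)"
  obtain T where T: "T > 0" "\<And>x t. norm x \<le> 1 \<Longrightarrow> 0 < t \<Longrightarrow> t < T \<Longrightarrow> t powr \<beta> * u x t \<le> c"
    unfolding \<beta>_def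
    using uniform_initial_decay[OF assms(1,2) lam assms(4,5) nonneg reg Lp conjunct2[OF ineq] c] by blast
  have "norm (SUP x\<in>cball 0 1. u x t) \<le> c * norm (t powr (- \<beta>))" if t: "0 < t" "t < T" for t
  proof -
    have le: "u x t \<le> c * t powr (- \<beta>)" if "x \<in> cball 0 1" for x
      using T(2)[of x t] that t by (simp add: powr_minus field_simps)
    have "(SUP x\<in>cball 0 1. u x t) \<le> c * t powr (- \<beta>)"
      by (rule cSUP_least) (use le in auto)
    \<comment> \<open>On the reals \<open>SUP\<close> dominates its members only for a family
      bounded above. This yields nonnegativity of the supremum, so that the norm can be
      removed.\<close>
    moreover have "bdd_above ((\<lambda>x. u x t) ` cball 0 1)"
      using le by (intro bdd_aboveI2)
    then have "u 0 t \<le> (SUP x\<in>cball 0 1. u x t)" by (rule cSUP_upper[rotated]) simp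
    then have "0 \<le> (SUP x\<in>cball 0 1. u x t)" using nonneg[of 0 t] by linarith
    ultimately show ?thesis by simp
  qed
  then have "eventually (\<lambda>t. norm (SUP x\<in>cball 0 1. u x t) \<le> c * norm (t powr (- \<beta>))) (at_right 0)"
    using T(1) by (auto simp: eventually_at_right_field)
  moreover have "- (real DIM('a) + 2) / (2 * lam) = - \<beta>" by (simp add: \<beta>_def minus_divide_left)
  ultimately show "eventually (\<lambda>t. norm (SUP x\<in>cball 0 1. u x t) \<le> c * norm (t powr (- (real DIM('a) + 2) / (2 * lam)))) (at_right 0)"
    by simp
qed

end
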